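(* Let $\mathfrak g$ be a simple Lie algebra with Dynkin vertex set $I$ and let $i\in I$. Let $t\in\mathbb C^\times$ not be a root of unity. Then the kernel of the screening operator $S_i^-$ is $$\operatorname{Ker} S^-_i=\mathbb C[Y_j(zt^{n})^{\pm1}]_{j\in I,\,j\neq i;\ n\in\mathbb Z}\otimes \mathbb C\big[\,Y_i(zt^{n})\big(1+A_i(zt^{n+1})^{-1}\big)\big]_{n\in\mathbb Z},$$ i.e. it is the subalgebra of $\mathbb C[Y_j(zt^n)^{\pm1}]_{j\in I,n\in\mathbb Z}$ generated by the $Y_j(zt^n)^{\pm1}$ with $j\ne i$ and the elements $Y_i(zt^n)(1+A_i(zt^{n+1})^{-1})$, $n\in\mathbb Z$.
   Context: $(C_{ij})_{i,j\in I}$ is the Cartan matrix of $\mathfrak g$, $C_{ij}=2(\alpha_i,\alpha_j)/(\alpha_i,\alpha_i)$, and $I_{ij}=2\delta_{ij}-C_{ij}$. $\mathcal Y=\mathbb C[Y_j(zt^n)^{\pm1}]_{j\in I,n\in\mathbb Z}$ is the Laurent polynomial algebra in independent variables $Y_j(zt^n)$ ($z$ is only a formal symbol). For $n\in\mathbb Z$ set $$A_i(zt^n)=Y_i(zt^{n+1})Y_i(zt^{n-1})\prod_{j\neq i}Y_j(zt^n)^{-I_{ji}}.$$ The screening operator $S_i^-$ is the derivation $$S_i^-:\mathcal Y\to \Big(\bigoplus_{m\in\mathbb Z}\mathcal Y\otimes S_i^-(zt^m)\Big)\Big/\big(S_i^-(zt^{m+2})-A_i(zt^{m+1})S_i^-(zt^m),\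 m\in\mathbb Z\big)$$ with values in the quotient of the free $\mathcal Y$-module on symbols $S_i^-(zt^m)$ by the $\mathcal Y$-submodule generated by the indicated elements, determined by $S_i^-\cdot Y_j(zt^n)^{\pm1}=\pm\delta_{ij}\,Y_j(zt^n)^{\pm1}\otimes S_i^-(zt^n)$. *)

theory Defs
  imports Complex_Main "HOL-Library.Poly_Mapping" "HOL-Library.Set_Algebras"
begin

section \<open>Cartan matrices of simple Lie algebras\<close>

locale lie_algebra = finite_dimensional_vector_space scale Basis
  for scale :: "complex \<Rightarrow> 'g::ab_group_add \<Rightarrow> 'g" and Basis :: "'g set" +
  fixes bracket :: "'g \<Rightarrow> 'g \<Rightarrow> 'g"
  assumes bracket_add_left: "bracket (x + y) w = bracket x w + bracket y w"
    and bracket_add_right: "bracket x (y + w) = bracket x y + bracket x w"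
    and bracket_scale_left: "bracket (scale c x) y = scale c (bracket x y)"
    and bracket_scale_right: "bracket x (scale c y) = scale c (bracket x y)"
    and bracket_self: "bracket x x = 0"
    and jacobi: "bracket x (bracket y w) + bracket y (bracket w x) + bracket w (bracket x y) = 0"
begin

definition lie_ideal :: "'g set \<Rightarrow> bool" where
  "lie_ideal J \<longleftrightarrow> subspace J \<and> (\<forall>x. \<forall>y\<in>J. bracket x y \<in> J)"

definition trace :: "('g \<Rightarrow> 'g) \<Rightarrow> complex" where
  "trace f = (\<Sum>b\<in>Basis. representation Basis (f b) b)"

definition killing_form :: "'g \<Rightarrow> 'g \<Rightarrow> complex" where
  "killing_form x y = trace (\<lambda>w. bracket x (bracket y w))"

definition ad_diagonalizable :: "'g \<Rightarrow> bool" where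
  "ad_diagonalizable x \<longleftrightarrow> span {v. \<exists>c. bracket x v = scale c v} = UNIV"

definition toral_subalgebra :: "'g set \<Rightarrow> bool" where
  "toral_subalgebra H \<longleftrightarrow> subspace H \<and> (\<forall>x\<in>H. ad_diagonalizable x) \<and>
     (\<forall>x\<in>H. \<forall>y\<in>H. bracket x y = 0)"

text \<open>For semisimple Lie algebras, Cartan subalgebras are the maximal toral ones.\<close>

definition cartan_subalgebra :: "'g set \<Rightarrow> bool" where
  "cartan_subalgebra H \<longleftrightarrow> toral_subalgebra H \<and>
     (\<forall>K. toral_subalgebra K \<and> H \<subseteq> K \<longrightarrow> K = H)"

text \<open>
  Linear functionals on \<open>H\<close> are represented by functions \<open>'g \<Rightarrow> complex\<close> of which only the
  values on \<open>H\<close> matter.  Linearity of a root on \<open>H\<close> follows from its root space being nonzero.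
\<close>

definition root_space :: "'g set \<Rightarrow> ('g \<Rightarrow> complex) \<Rightarrow> 'g set" where
  "root_space H \<beta> = {x. \<forall>h\<in>H. bracket h x = scale (\<beta> h) x}"

definition is_root :: "'g set \<Rightarrow> ('g \<Rightarrow> complex) \<Rightarrow> bool" where
  "is_root H \<beta> \<longleftrightarrow> (\<exists>h\<in>H. \<beta> h \<noteq> 0) \<and> root_space H \<beta> \<noteq> {0}"

definition simple_root_system :: "'g set \<Rightarrow> ('i::finite \<Rightarrow> 'g \<Rightarrow> complex) \<Rightarrow> bool" where
  "simple_root_system H \<alpha> \<longleftrightarrow>
     (\<forall>i. is_root H (\<alpha> i)) \<and>
     (\<forall>c. (\<forall>h\<in>H. (\<Sum>i\<in>UNIV. c i * \<alpha> i h) = 0) \<longrightarrow> (\<forall>i. c i = 0)) \<and>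
     (\<forall>\<beta>. is_root H \<beta> \<longrightarrow> (\<exists>k :: 'i \<Rightarrow> nat.
        (\<forall>h\<in>H. \<beta> h = (\<Sum>i\<in>UNIV. of_nat (k i) * \<alpha> i h)) \<or>
        (\<forall>h\<in>H. \<beta> h = - (\<Sum>i\<in>UNIV. of_nat (k i) * \<alpha> i h))))"

text \<open>
  The form on the dual of \<open>H\<close> induced by the Killing form.  The Cartan integers
  \<open>2(\<alpha>\<^sub>i,\<alpha>\<^sub>j)/(\<alpha>\<^sub>i,\<alpha>\<^sub>i)\<close> do not depend on the normalization of the invariant form.
\<close>

definition killing_dual :: "'g set \<Rightarrow> ('g \<Rightarrow> complex) \<Rightarrow> 'g" where
  "killing_dual H \<beta> = (THE x. x \<in> H \<and> (\<forall>h\<in>H. killing_form x h = \<beta> h))"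

definition root_form :: "'g set \<Rightarrow> ('g \<Rightarrow> complex) \<Rightarrow> ('g \<Rightarrow> complex) \<Rightarrow> complex" where
  "root_form H \<beta> \<gamma> = killing_form (killing_dual H \<beta>) (killing_dual H \<gamma>)"

end

locale simple_lie_algebra = lie_algebra scale Basis bracket
  for scale :: "complex \<Rightarrow> 'g::ab_group_add \<Rightarrow> 'g" and Basis bracket +
  assumes nonabelian: "\<exists>x y. bracket x y \<noteq> 0"
    and ideals_trivial: "lie_ideal J \<Longrightarrow> J = {0} \<or> J = UNIV"

locale simple_lie_algebra_with_cartan_matrix = simple_lie_algebra scale Basis bracket
  for scale :: "complex \<Rightarrow> 'g::ab_group_add \<Rightarrow> 'g" and Basis bracket +
  fixes H :: "'g set"
    and \<alpha> :: "'i::finite \<Rightarrow> 'g \<Rightarrow> complex"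
    and C :: "'i \<Rightarrow> 'i \<Rightarrow> int"
  assumes cartan: "cartan_subalgebra H"
    and simple_roots: "simple_root_system H \<alpha>"
    and cartan_matrix:
      "of_int (C i j) = 2 * root_form H (\<alpha> i) (\<alpha> j) / root_form H (\<alpha> i) (\<alpha> i)"

definition incidence_matrix :: "('i \<Rightarrow> 'i \<Rightarrow> int) \<Rightarrow> 'i \<Rightarrow> 'i \<Rightarrow> int" where
  "incidence_matrix C i j = 2 * (if i = j then 1 else 0) - C i j"

section \<open>Free modules, submodules and tensor products\<close>

text \<open>
  \<open>'k \<Rightarrow>\<^sub>0 'r\<close> is the free module over the commutative ring \<open>'r\<close> with basis \<open>'k\<close>; the basis
  vector of \<open>k\<close> is \<open>Poly_Mapping.single k 1\<close>.
\<close>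

definition smult :: "'r::comm_ring_1 \<Rightarrow> ('k \<Rightarrow>\<^sub>0 'r) \<Rightarrow> 'k \<Rightarrow>\<^sub>0 'r" where
  "smult r m = Poly_Mapping.map ((*) r) m"

inductive_set submodule_generated ::
    "'r::comm_ring_1 set \<Rightarrow> ('k \<Rightarrow>\<^sub>0 'r) set \<Rightarrow> ('k \<Rightarrow>\<^sub>0 'r) set"
  for R :: "'r set" and G :: "('k \<Rightarrow>\<^sub>0 'r) set" where
  zero: "0 \<in> submodule_generated R G"
| gen: "g \<in> G \<Longrightarrow> g \<in> submodule_generated R G"
| add: "x \<in> submodule_generated R G \<Longrightarrow> y \<in> submodule_generated R G \<Longrightarrow>
    x + y \<in> submodule_generated R G"
| scale: "r \<in> R \<Longrightarrow> x \<in> submodule_generated R G \<Longrightarrow> smult r x \<in> submodule_generated R G"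

text \<open>
  The quotient of a module by a submodule \<open>N\<close> consists of the cosets \<open>m +o N\<close>.  Cosets are added
  as sets; scalars act by \<open>r \<cdot> (m + N) = r m + N\<close>.
\<close>

definition coset_smult ::
    "('k \<Rightarrow>\<^sub>0 'r::comm_ring_1) set \<Rightarrow> 'r \<Rightarrow> ('k \<Rightarrow>\<^sub>0 'r) set \<Rightarrow> ('k \<Rightarrow>\<^sub>0 'r) set" where
  "coset_smult N r X = smult r ` X + N"

section \<open>The Laurent polynomial algebra\<close>

text \<open>
  Laurent polynomials in independent variables \<open>Y\<^sub>j(za)\<close> with \<open>a\<close> a complex number: a monomial is
  its finitely supported exponent function on the pairs \<open>(j, a)\<close>, the formal symbol \<open>z\<close> being
  suppressed.
\<close>

type_synonym 'i laurent = "(('i \<times> complex) \<Rightarrow>\<^sub>0 int) \<Rightarrow>\<^sub>0 complex"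

definition const :: "complex \<Rightarrow> 'i laurent" where
  "const c = Poly_Mapping.single 0 c"

text \<open>\<open>Ypow j a k\<close> is the power \<open>Y\<^sub>j(za)\<^sup>k\<close>.\<close>

definition Ypow :: "'i \<Rightarrow> complex \<Rightarrow> int \<Rightarrow> 'i laurent" where
  "Ypow j a k = Poly_Mapping.single (Poly_Mapping.single (j, a) k) 1"

inductive_set subalgebra_generated :: "'i laurent set \<Rightarrow> 'i laurent set"
  for G :: "'i laurent set" where
  const: "const c \<in> subalgebra_generated G"
| gen: "g \<in> G \<Longrightarrow> g \<in> subalgebra_generated G"
| add: "f \<in> subalgebra_generated G \<Longrightarrow> g \<in> subalgebra_generated G \<Longrightarrow>
    f + g \<in> subalgebra_generated G"
| mult: "f \<in> subalgebra_generated G \<Longrightarrow> g \<in> subalgebra_generated G \<Longrightarrow>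
    f * g \<in> subalgebra_generated G"

text \<open>
  The generators \<open>Y\<^sub>j(zt\<^sup>n)\<^sup>\<plusminus>\<^sup>1\<close> with \<open>j\<close> in \<open>J\<close>.  When \<open>t\<close> is nonzero and not a root of unity, the
  points \<open>t\<^sup>n\<close> are pairwise distinct, hence these \<open>Y\<^sub>j(zt\<^sup>n)\<close> are independent variables.
\<close>

definition Y_gens :: "complex \<Rightarrow> 'i set \<Rightarrow> 'i laurent set" where
  "Y_gens t J = {Ypow j (t powi n) s | j n s. j \<in> J \<and> s \<in> {1, -1}}"

definition Y_algebra :: "complex \<Rightarrow> 'i laurent set" where
  "Y_algebra t = subalgebra_generated (Y_gens t UNIV)"

definition A :: "('i::finite \<Rightarrow> 'i \<Rightarrow> int) \<Rightarrow> complex \<Rightarrow> 'i \<Rightarrow> int \<Rightarrow> 'i laurent" where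
  "A C t i n = Ypow i (t powi (n + 1)) 1 * Ypow i (t powi (n - 1)) 1 *
     (\<Prod>j\<in>UNIV - {i}. Ypow j (t powi n) (- incidence_matrix C j i))"

definition unit_inverse :: "'r::comm_ring_1 \<Rightarrow> 'r" where
  "unit_inverse x = (THE y. x * y = 1)"

definition T_gens :: "('i::finite \<Rightarrow> 'i \<Rightarrow> int) \<Rightarrow> complex \<Rightarrow> 'i \<Rightarrow> 'i laurent set" where
  "T_gens C t i = {Ypow i (t powi n) 1 * (1 + unit_inverse (A C t i (n + 1))) | n. True}"

text \<open>
  The tensor product over the complex numbers of subspaces \<open>U\<close> and \<open>V\<close> is the free vector space
  on \<open>U \<times> V\<close> modulo the bilinearity relations.  \<open>is_tensor_product U V K\<close> says that multiplication
  \<open>u \<otimes> v \<mapsto> u v\<close> is a well-defined bijection from it onto \<open>K\<close>.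
\<close>

definition free_on :: "'k set \<Rightarrow> ('k \<Rightarrow>\<^sub>0 complex) set" where
  "free_on X = {w. Poly_Mapping.keys w \<subseteq> X}"

definition bilinear_relations ::
    "'i laurent set \<Rightarrow> 'i laurent set \<Rightarrow> (('i laurent \<times> 'i laurent) \<Rightarrow>\<^sub>0 complex) set" where
  "bilinear_relations U V =
     (let e = (\<lambda>u v. Poly_Mapping.single (u, v) (1::complex)) in
      submodule_generated UNIV
       ({e (u + u') v - e u v - e u' v | u u' v. u \<in> U \<and> u' \<in> U \<and> v \<in> V} \<union>
        {e u (v + v') - e u v - e u v' | u v v'. u \<in> U \<and> v \<in> V \<and> v' \<in> V} \<union>
        {e (const c * u) v - smult c (e u v) | c u v. u \<in> U \<and> v \<in> V} \<union>
        {e u (const c * v) - smult c (e u v) | c u v. u \<in> U \<and> v \<in> V}))"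

definition multiplication_map :: "(('i laurent \<times> 'i laurent) \<Rightarrow>\<^sub>0 complex) \<Rightarrow> 'i laurent" where
  "multiplication_map w =
     (\<Sum>p\<in>Poly_Mapping.keys w. const (Poly_Mapping.lookup w p) * fst p * snd p)"

definition is_tensor_product :: "'i laurent set \<Rightarrow> 'i laurent set \<Rightarrow> 'i laurent set \<Rightarrow> bool" where
  "is_tensor_product U V K \<longleftrightarrow>
     multiplication_map ` free_on (U \<times> V) = K \<and>
     {w \<in> free_on (U \<times> V). multiplication_map w = 0} = bilinear_relations U V"

section \<open>The screening operator\<close>

text \<open>The basis vector at \<open>a\<close> is the symbol \<open>S\<^sub>i\<^sup>-(za)\<close>.\<close>

type_synonym 'i screening_module = "complex \<Rightarrow>\<^sub>0 'i laurent"

definition S_sym :: "complex \<Rightarrow> 'i screening_module" where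
  "S_sym a = Poly_Mapping.single a 1"

definition S_free :: "complex \<Rightarrow> 'i screening_module set" where
  "S_free t = submodule_generated (Y_algebra t) {S_sym (t powi m) | m. True}"

definition S_relations ::
    "('i::finite \<Rightarrow> 'i \<Rightarrow> int) \<Rightarrow> complex \<Rightarrow> 'i \<Rightarrow> 'i screening_module set" where
  "S_relations C t i = submodule_generated (Y_algebra t)
     {S_sym (t powi (m + 2)) - smult (A C t i (m + 1)) (S_sym (t powi m)) | m. True}"

definition S_quotient ::
    "('i::finite \<Rightarrow> 'i \<Rightarrow> int) \<Rightarrow> complex \<Rightarrow> 'i \<Rightarrow> 'i screening_module set set" where
  "S_quotient C t i = {m +o S_relations C t i | m. m \<in> S_free t}"

definition screening_operator ::
    "('i::finite \<Rightarrow> 'i \<Rightarrow> int) \<Rightarrow> complex \<Rightarrow> 'i \<Rightarrow> ('i laurent \<Rightarrow> 'i screening_module set) \<Rightarrow> bool"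
where
  "screening_operator C t i S \<longleftrightarrow>
     (let N = S_relations C t i in
      (\<forall>f\<in>Y_algebra t. S f \<in> S_quotient C t i) \<and>
      (\<forall>f\<in>Y_algebra t. \<forall>g\<in>Y_algebra t. S (f + g) = S f + S g) \<and>
      (\<forall>c. \<forall>f\<in>Y_algebra t. S (const c * f) = coset_smult N (const c) (S f)) \<and>
      (\<forall>f\<in>Y_algebra t. \<forall>g\<in>Y_algebra t.
         S (f * g) = coset_smult N f (S g) + coset_smult N g (S f)) \<and>
      (\<forall>j n. \<forall>s\<in>{1, -1}.
         S (Ypow j (t powi n) s) =
           smult (of_int (s * (if i = j then 1 else 0)) * Ypow j (t powi n) s)
             (S_sym (t powi n)) +o N))"

text \<open>The zero of the quotient module is the coset \<open>S_relations C t i\<close>.\<close>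

definition screening_kernel ::
    "('i::finite \<Rightarrow> 'i \<Rightarrow> int) \<Rightarrow> complex \<Rightarrow> 'i \<Rightarrow> ('i laurent \<Rightarrow> 'i screening_module set) \<Rightarrow>
      'i laurent set" where
  "screening_kernel C t i S = {f \<in> Y_algebra t. S f = S_relations C t i}"

text \<open>
  The operator exists: \<open>f \<mapsto> (\<Sum>a. (Y\<^sub>i(za) \<partial>f/\<partial>Y\<^sub>i(za)) S\<^sub>i\<^sup>-(za)) + N\<close> satisfies the specification.
\<close>

definition S_lift :: "'i \<Rightarrow> 'i laurent \<Rightarrow> 'i screening_module" where
  "S_lift i f = (\<Sum>e\<in>Poly_Mapping.keys f. \<Sum>p\<in>Poly_Mapping.keys e.
     if fst p = i then Poly_Mapping.single (snd p)
       (Poly_Mapping.single e (of_int (Poly_Mapping.lookup e p) * Poly_Mapping.lookup f e)) else 0)"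

lemma lookup_smult [simp]: "Poly_Mapping.lookup (smult r m) k = r * Poly_Mapping.lookup m k"
  by (simp add: smult_def Poly_Mapping.map.rep_eq when_def)

lemma smult_single [simp]: "smult r (Poly_Mapping.single k x) = Poly_Mapping.single k (r * x)"
  by (simp add: smult_def)

lemma smult_add_right: "smult r (x + y) = smult r x + smult r y"
  by (rule poly_mapping_eqI) (simp add: lookup_add distrib_left)

lemma smult_add_left: "smult (r + s) x = smult r x + smult s x"
  by (rule poly_mapping_eqI) (simp add: lookup_add distrib_right)

lemma smult_smult: "smult r (smult s x) = smult (r * s) x"
  by (rule poly_mapping_eqI) (simp add: mult.assoc)

lemma smult_zero_right [simp]: "smult r 0 = 0"
  by (rule poly_mapping_eqI) simp

lemma smult_zero_left [simp]: "smult 0 x = 0"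
  by (rule poly_mapping_eqI) simp

lemma smult_minus_one: "smult (- 1) x = - x"
  by (rule poly_mapping_eqI) simp

lemma lookup_S_lift:
  "Poly_Mapping.lookup (Poly_Mapping.lookup (S_lift i f) a) e =
     of_int (Poly_Mapping.lookup e (i, a)) * Poly_Mapping.lookup f e"
proof -
  have inner: "(\<Sum>p\<in>Poly_Mapping.keys d. Poly_Mapping.lookup (Poly_Mapping.lookup
      (if fst p = i then Poly_Mapping.single (snd p)
        (Poly_Mapping.single d (of_int (Poly_Mapping.lookup d p) * Poly_Mapping.lookup f d))
       else 0) a) e)
    = (if d = e then of_int (Poly_Mapping.lookup e (i, a)) * Poly_Mapping.lookup f e else 0)"
    (is "sum ?g _ = _") for d
  proof -
    have "sum ?g (Poly_Mapping.keys d) = (\<Sum>p\<in>Poly_Mapping.keys d. if p = (i, a) then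
        (if d = e then of_int (Poly_Mapping.lookup e (i, a)) * Poly_Mapping.lookup f e else 0)
        else 0)"
      by (rule sum.cong) (auto simp: lookup_single when_def)
    then show ?thesis
      by (auto simp: in_keys_iff)
  qed
  show ?thesis
    unfolding S_lift_def lookup_sum inner by (auto simp: in_keys_iff)
qed

lemma S_lift_add: "S_lift i (f + g) = S_lift i f + S_lift i g"
  by (intro poly_mapping_eqI) (simp add: lookup_S_lift lookup_add distrib_left)

lemma S_lift_zero [simp]: "S_lift i 0 = 0"
  by (intro poly_mapping_eqI) (simp add: lookup_S_lift)

lemma S_lift_sum: "S_lift i (sum f X) = (\<Sum>x\<in>X. S_lift i (f x))"
  by (induction X rule: infinite_finite_induct) (simp_all add: S_lift_add)

lemma poly_mapping_eq_sum_single: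
  "f = (\<Sum>e\<in>Poly_Mapping.keys f. Poly_Mapping.single e (Poly_Mapping.lookup f e))"
  by (rule poly_mapping_eqI) (auto simp: lookup_sum lookup_single when_def in_keys_iff)

lemma lookup_S_lift_single:
  "Poly_Mapping.lookup (S_lift i (Poly_Mapping.single e c)) a =
     Poly_Mapping.single e (of_int (Poly_Mapping.lookup e (i, a)) * c)"
  by (rule poly_mapping_eqI) (auto simp: lookup_S_lift lookup_single when_def)

lemma S_lift_mult_single:
  "S_lift i (Poly_Mapping.single d c * Poly_Mapping.single e c') =
     smult (Poly_Mapping.single d c) (S_lift i (Poly_Mapping.single e c')) +
     smult (Poly_Mapping.single e c') (S_lift i (Poly_Mapping.single d c))"
proof (rule poly_mapping_eqI)
  fix a
  have eq: "e + d = d + e" by (simp add: add.commute)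
  show "Poly_Mapping.lookup (S_lift i (Poly_Mapping.single d c * Poly_Mapping.single e c')) a =
    Poly_Mapping.lookup (smult (Poly_Mapping.single d c) (S_lift i (Poly_Mapping.single e c')) +
     smult (Poly_Mapping.single e c') (S_lift i (Poly_Mapping.single d c))) a"
    by (simp add: lookup_S_lift_single mult_single lookup_add eq algebra_simps flip: single_add)
qed

lemma smult_sum_right: "smult r (sum f X) = (\<Sum>x\<in>X. smult r (f x))"
  by (induction X rule: infinite_finite_induct) (simp_all add: smult_add_right)

lemma smult_sum_left: "smult (sum f X) m = (\<Sum>x\<in>X. smult (f x) m)"
  by (induction X rule: infinite_finite_induct) (simp_all add: smult_add_left)

lemma S_lift_mult: "S_lift i (f * g) = smult f (S_lift i g) + smult g (S_lift i f)"
proof -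
  have *: "S_lift i (Poly_Mapping.single d c * g) =
     smult (Poly_Mapping.single d c) (S_lift i g) +
     smult g (S_lift i (Poly_Mapping.single d c))" for d c
  proof -
    let ?s = "\<lambda>e. Poly_Mapping.single e (Poly_Mapping.lookup g e)"
    have "S_lift i (Poly_Mapping.single d c * (\<Sum>e\<in>Poly_Mapping.keys g. ?s e)) =
       smult (Poly_Mapping.single d c) (S_lift i (\<Sum>e\<in>Poly_Mapping.keys g. ?s e)) +
       smult (\<Sum>e\<in>Poly_Mapping.keys g. ?s e) (S_lift i (Poly_Mapping.single d c))"
      by (simp only: sum_distrib_left S_lift_sum S_lift_mult_single sum.distrib smult_sum_right
          smult_sum_left)
    then show ?thesis by (simp only: poly_mapping_eq_sum_single[of g, symmetric])
  qed
  let ?s = "\<lambda>e. Poly_Mapping.single e (Poly_Mapping.lookup f e)"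
  have "S_lift i ((\<Sum>e\<in>Poly_Mapping.keys f. ?s e) * g) =
     smult (\<Sum>e\<in>Poly_Mapping.keys f. ?s e) (S_lift i g) +
     smult g (S_lift i (\<Sum>e\<in>Poly_Mapping.keys f. ?s e))"
    by (simp only: sum_distrib_right S_lift_sum * sum.distrib smult_sum_right smult_sum_left)
  then show ?thesis by (simp only: poly_mapping_eq_sum_single[of f, symmetric])
qed

lemma S_lift_const [simp]: "S_lift i (const c) = 0"
  by (intro poly_mapping_eqI)
    (simp add: lookup_S_lift const_def lookup_single when_def)

lemma S_lift_Ypow:
  "S_lift i (Ypow j a s) = smult (of_int (s * (if i = j then 1 else 0)) * Ypow j a s) (S_sym a)"
proof (rule poly_mapping_eqI)
  fix b
  have of_int: "of_int k = (Poly_Mapping.single 0 (of_int k) :: 'a laurent)" for k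
    by simp
  show "Poly_Mapping.lookup (S_lift i (Ypow j a s)) b =
    Poly_Mapping.lookup (smult (of_int (s * (if i = j then 1 else 0)) * Ypow j a s) (S_sym a)) b"
    unfolding of_int
    by (auto simp: Ypow_def S_sym_def lookup_S_lift_single lookup_single when_def mult_single
        simp del: single_of_int)
qed

lemma S_lift_in_S_free:
  assumes "f \<in> Y_algebra t"
  shows "S_lift i f \<in> S_free t"
  using assms unfolding Y_algebra_def
proof induction
  case (const c)
  then show ?case by (simp add: S_free_def submodule_generated.zero)
next
  case (gen g)
  then obtain j n s where g: "g = Ypow j (t powi n) s" "s = 1 \<or> s = -1"
    by (auto simp: Y_gens_def)
  have "Ypow j (t powi n) s \<in> Y_algebra t"
    unfolding Y_algebra_def
    by (rule subalgebra_generated.gen) (use g in \<open>auto simp: Y_gens_def\<close>)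
  moreover have "of_int k = const (of_int k)" for k
    by (simp add: const_def)
  ultimately have "of_int (s * (if i = j then 1 else 0)) * Ypow j (t powi n) s \<in> Y_algebra t"
    unfolding Y_algebra_def
    by (metis subalgebra_generated.const subalgebra_generated.mult)
  then show ?case
    unfolding g S_lift_Ypow S_free_def
    by (intro submodule_generated.scale submodule_generated.gen) auto
next
  case (add f g)
  then show ?case by (simp add: S_lift_add S_free_def submodule_generated.add)
next
  case (mult f g)
  then show ?case
    by (auto simp: S_lift_mult S_free_def Y_algebra_def
        intro!: submodule_generated.add submodule_generated.scale)
qed

lemma submodule_generated_set_plus:
  "submodule_generated R G + submodule_generated R G = submodule_generated R G"
proof
  show "submodule_generated R G + submodule_generated R G \<subseteq> submodule_generated R G"
    by (auto simp: set_plus_def intro: submodule_generated.add)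
  show "submodule_generated R G \<subseteq> submodule_generated R G + submodule_generated R G"
  proof
    fix x assume "x \<in> submodule_generated R G"
    then show "x \<in> submodule_generated R G + submodule_generated R G"
      using set_plus_intro[of x _ 0] submodule_generated.zero[of R G] by fastforce
  qed
qed

lemma coset_plus:
  fixes N :: "('k \<Rightarrow>\<^sub>0 'r::comm_ring_1) set"
  assumes "N + N = N"
  shows "(m +o N) + (m' +o N) = (m + m') +o N"
  using assms by (metis set_plus_rearrange)

lemma coset_smult_coset:
  assumes N: "N = submodule_generated R G" and r: "r \<in> R"
  shows "coset_smult N r (m +o N) = smult r m +o N"
proof
  show "coset_smult N r (m +o N) \<subseteq> smult r m +o N"
  proof
    fix x assume "x \<in> coset_smult N r (m +o N)"
    then obtain n n' where n: "n \<in> N" "n' \<in> N" "x = smult r (m + n) + n'"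
      by (auto simp: coset_smult_def set_plus_def elt_set_plus_def)
    then have "x = smult r m + (smult r n + n')"
      by (simp add: smult_add_right add.assoc)
    moreover have "smult r n + n' \<in> N"
      using n r unfolding N by (auto intro: submodule_generated.intros)
    ultimately show "x \<in> smult r m +o N" by (auto simp: elt_set_plus_def)
  qed
  show "smult r m +o N \<subseteq> coset_smult N r (m +o N)"
  proof
    fix x assume "x \<in> smult r m +o N"
    then obtain n where n: "n \<in> N" "x = smult r m + n"
      by (auto simp: elt_set_plus_def)
    moreover have "m \<in> m +o N"
      using submodule_generated.zero[of R G] unfolding N elt_set_plus_def by force
    ultimately show "x \<in> coset_smult N r (m +o N)"
      by (auto simp: coset_smult_def set_plus_def)
  qed
qed

lemma screening_operator_exists:
  fixes C :: "'i::finite \<Rightarrow> 'i \<Rightarrow> int"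
  shows "screening_operator C t i (\<lambda>f. S_lift i f +o S_relations C t i)"
proof -
  define N where "N = S_relations C t i"
  have N: "N + N = N"
    unfolding N_def S_relations_def by (rule submodule_generated_set_plus)
  have sm: "coset_smult N r (m +o N) = smult r m +o N" if "r \<in> Y_algebra t" for r m
    by (rule coset_smult_coset[OF _ that]) (simp add: N_def S_relations_def)
  have c: "(const c :: 'i laurent) \<in> Y_algebra t" for c
    unfolding Y_algebra_def by (rule subalgebra_generated.const)
  show ?thesis
    unfolding screening_operator_def Let_def N_def[symmetric]
  proof (intro conjI ballI allI)
    fix f :: "'i laurent" assume "f \<in> Y_algebra t"
    then show "S_lift i f +o N \<in> S_quotient C t i"
      unfolding S_quotient_def N_def by (auto intro: S_lift_in_S_free)
  next
    fix f g :: "'i laurent"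
    show "S_lift i (f + g) +o N = (S_lift i f +o N) + (S_lift i g +o N)"
      by (simp only: coset_plus[OF N] S_lift_add)
  next
    fix c and f :: "'i laurent"
    show "S_lift i (const c * f) +o N = coset_smult N (const c) (S_lift i f +o N)"
      by (simp only: sm[OF c] S_lift_mult S_lift_const smult_zero_right add_0_right)
  next
    fix f g :: "'i laurent" assume "f \<in> Y_algebra t" "g \<in> Y_algebra t"
    then show "S_lift i (f * g) +o N =
        coset_smult N f (S_lift i g +o N) + coset_smult N g (S_lift i f +o N)"
      by (simp only: sm coset_plus[OF N] S_lift_mult)
  next
    fix j n and s :: int
    show "S_lift i (Ypow j (t powi n) s) +o N =
        smult (of_int (s * (if i = j then 1 else 0)) * Ypow j (t powi n) s)
          (S_sym (t powi n)) +o N"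
      by (simp only: S_lift_Ypow)
  qed
qed

end

theory Submission
  imports Defs
begin

text \<open>
  The quotient module is free on two generators, one for each parity of the index, so
  membership in the kernel is a system of linear equations between the coefficients of a Laurent
  polynomial.  These equations force every nonzero element of the kernel to contain a dominant
  monomial, that is, one with nonnegative exponents at all variables \<open>Y\<^sub>i\<close>.  A generator
  \<open>Y\<^sub>i(zt\<^sup>n)(1 + A\<^sub>i(zt\<^sup>n\<^sup>+\<^sup>1)\<^sup>-\<^sup>1)\<close> is \<open>Y\<^sub>i(zt\<^sup>n)\<close> plus a term of lower degree in the
  \<open>Y\<^sub>i\<close>, so one can subtract products of generators until no dominant monomial is left.  The same
  leading terms show that the products of generators are linearly independent, which is the
  tensor product decomposition.
\<close>

abbreviation lookup where "lookup \<equiv> Poly_Mapping.lookup"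
abbreviation keys where "keys \<equiv> Poly_Mapping.keys"
abbreviation single where "single \<equiv> Poly_Mapping.single"

section \<open>Finitely supported functions\<close>

text \<open>Linear extension of \<open>W\<close> from the basis vectors. It is applied to the
  screening module, with Laurent polynomial values, and to exponent vectors, where it gives the
  degree.\<close>

definition extend :: "('k \<Rightarrow> 'r::comm_ring_1) \<Rightarrow> ('k \<Rightarrow>\<^sub>0 'r) \<Rightarrow> 'r" where
  "extend W x = (\<Sum>k\<in>keys x. lookup x k * W k)"

lemma extend_superset:
  assumes "finite K" "keys x \<subseteq> K"
  shows "extend W x = (\<Sum>k\<in>K. lookup x k * W k)"
  unfolding extend_def by (rule sum.mono_neutral_left) (use assms in \<open>auto simp: in_keys_iff\<close>)

lemma extend_add: "extend W (x + y) = extend W x + extend W y"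
  unfolding extend_def by (rule setsum_keys_plus_distrib) (simp_all add: algebra_simps)

lemma extend_zero [simp]: "extend W 0 = 0"
  by (simp add: extend_def)

lemma extend_uminus: "extend W (- x) = - extend W x"
  using extend_add[of W x "- x"] by (simp add: eq_neg_iff_add_eq_0 add.commute)

lemma extend_diff: "extend W (x - y) = extend W x - extend W y"
  using extend_add[of W x "- y"] by (simp add: extend_uminus)

lemma extend_sum: "extend W (sum f X) = (\<Sum>x\<in>X. extend W (f x))"
  by (induction X rule: infinite_finite_induct) (simp_all add: extend_add)

lemma extend_single [simp]: "extend W (single k c) = c * W k"
  by (simp add: extend_def)

lemma keys_smult_subset: "keys (smult r x) \<subseteq> keys x"
  by (auto simp: in_keys_iff)

lemma extend_smult: "extend W (smult r x) = r * extend W x"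
  unfolding extend_superset[OF finite_keys keys_smult_subset]
  by (simp add: extend_def sum_distrib_left mult.assoc)

lemma single_induct_subset:
  fixes e :: "'a \<Rightarrow>\<^sub>0 'b::comm_monoid_add"
  assumes "keys e \<subseteq> X" and "P 0" and "\<And>x y. P x \<Longrightarrow> P y \<Longrightarrow> P (x + y)"
    and "\<And>k. k \<in> X \<Longrightarrow> P (single k (lookup e k))"
  shows "P e"
proof -
  have "P (\<Sum>k\<in>K. single k (lookup e k))" if "finite K" "K \<subseteq> X" for K
    using that by (induction K rule: finite_induct) (auto simp: assms)
  from this[OF finite_keys assms(1)] show ?thesis
    by (simp flip: poly_mapping_eq_sum_single)
qed

text \<open>By cancellation the shift by \<open>u\<close> is injective, so a single term of
  \<open>f\<close> contributes to the coefficient.\<close>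

lemma lookup_single_times:
  fixes u e :: "'a::cancel_comm_monoid_add" and f :: "'a \<Rightarrow>\<^sub>0 'b::comm_ring_1"
  shows "lookup (single u c * f) (u + e) = c * lookup f e"
proof -
  have "single u c * f = (\<Sum>d\<in>keys f. single (u + d) (c * lookup f d))"
    by (subst (1) poly_mapping_eq_sum_single[of f]) (simp add: sum_distrib_left mult_single)
  then have "lookup (single u c * f) (u + e) = (\<Sum>d\<in>keys f. if d = e then c * lookup f d else 0)"
    by (auto simp: lookup_sum lookup_single when_def intro!: sum.cong)
  then show ?thesis
    by (auto simp: in_keys_iff)
qed

lemma keys_single_times:
  fixes f :: "'a::ab_group_add \<Rightarrow>\<^sub>0 'b::comm_ring_1"
  shows "keys (single u c * f) \<subseteq> (+) u ` keys f"
  using keys_mult[of "single u c" f] by (auto split: if_splits)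

lemma keys_minus_subset:
  fixes f g :: "'a \<Rightarrow>\<^sub>0 'b::ab_group_add"
  shows "keys (f - g) \<subseteq> keys f \<union> keys g"
  by (auto simp: in_keys_iff lookup_minus)

section \<open>Recursions indexed by the integers\<close>

lemma exists_step_solution:
  fixes b :: "int \<Rightarrow> 'a::ab_group_add"
  shows "\<exists>s. \<forall>k. s (k + 1) = s k + b k"
proof -
  \<comment> \<open>The oriented sum of \<open>b\<close> from 0 to \<open>k\<close>; for each
    \<open>k\<close> at least one of the two sums is empty.\<close>
  define s where "s k = sum b {0..<k} - sum b {k..<0}" for k
  have "s (k + 1) = s k + b k" for k
  proof (cases "0 \<le> k")
    case True
    then have "{0..<k + 1} = insert k {0..<k}" by auto
    then show ?thesis using True by (simp add: s_def)
  next
    case False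
    then have "{k..<0} = insert k {k + 1..<0}" by auto
    then show ?thesis using False by (simp add: s_def)
  qed
  then show ?thesis by blast
qed

lemma exists_two_step_solution:
  fixes b :: "int \<Rightarrow> 'a::ab_group_add"
  obtains u where "\<And>n. u (n + 2) = u n + b n"
proof -
  \<comment> \<open>The recursion decouples over residues mod 2: \<open>s r k\<close> is the value
    at the index \<open>2 * k + r\<close>.\<close>
  have "\<exists>s. \<forall>k. s (k + 1) = s k + b (2 * k + r)" for r
    by (rule exists_step_solution)
  then obtain s where s: "\<And>r k. s r (k + 1) = s r k + b (2 * k + r)" by metis
  show ?thesis
  proof
    fix n :: int
    have "(n + 2) div 2 = n div 2 + 1" "(n + 2) mod 2 = n mod 2" "2 * (n div 2) + n mod 2 = n"
      by simp_all
    then show "s ((n + 2) mod 2) ((n + 2) div 2) = s (n mod 2) (n div 2) + b n"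
      by (metis s)
  qed
qed

section \<open>Subalgebras\<close>

lemma const_add: "const (a + b) = const a + const b"
  by (simp add: const_def single_add)

lemma const_mult: "const (a * b) = const a * const b"
  by (simp add: const_def mult_single)

lemma const_0 [simp]: "const 0 = 0" and const_1 [simp]: "const 1 = 1"
  by (simp_all add: const_def)

lemma const_uminus: "const (- c) = - const c"
  by (simp add: const_def single_uminus)

lemma lookup_const_times [simp]: "lookup (const c * f) e = c * lookup f e"
  using lookup_single_times[of 0 c f e] by (simp add: const_def)

lemma subalgebra_zero: "0 \<in> subalgebra_generated G"
  and subalgebra_one: "1 \<in> subalgebra_generated G"
  using subalgebra_generated.const[of 0 G] subalgebra_generated.const[of 1 G] by simp_all

lemma subalgebra_power: "f \<in> subalgebra_generated G \<Longrightarrow> f ^ n \<in> subalgebra_generated G"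
  by (induction n) (auto intro: subalgebra_generated.mult subalgebra_one)

lemma subalgebra_sum:
  "(\<And>x. x \<in> X \<Longrightarrow> f x \<in> subalgebra_generated G) \<Longrightarrow> sum f X \<in> subalgebra_generated G"
  by (induction X rule: infinite_finite_induct)
    (auto intro: subalgebra_generated.add subalgebra_zero)

lemma subalgebra_prod:
  "(\<And>x. x \<in> X \<Longrightarrow> f x \<in> subalgebra_generated G) \<Longrightarrow> prod f X \<in> subalgebra_generated G"
  by (induction X rule: infinite_finite_induct)
    (auto intro: subalgebra_generated.mult subalgebra_one)

lemma subalgebra_const_times:
  "f \<in> subalgebra_generated G \<Longrightarrow> const c * f \<in> subalgebra_generated G"
  by (intro subalgebra_generated.mult subalgebra_generated.const)

lemma subalgebra_least:
  assumes "f \<in> subalgebra_generated G" "G \<subseteq> subalgebra_generated G'"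
  shows "f \<in> subalgebra_generated G'"
  using assms(1)
  by induction (use assms(2) in \<open>auto intro: subalgebra_generated.intros\<close>)

section \<open>Monomials and supports\<close>

lemma Ypow_0 [simp]: "Ypow j a 0 = 1"
  by (simp add: Ypow_def)

lemma Ypow_add: "Ypow j a (k + l) = Ypow j a k * Ypow j a l"
  by (simp add: Ypow_def mult_single single_add)

text \<open>Only the exponents 1 and -1 are generators, hence an induction upwards and downwards
  from 0.\<close>

lemma Ypow_in_subalgebra:
  assumes "j \<in> J"
  shows "Ypow j (t powi n) k \<in> subalgebra_generated (Y_gens t J)"
proof (induction k rule: int_induct[where k = 0])
  case base
  then show ?case by (simp add: subalgebra_one)
next
  case (step1 k)
  have "Ypow j (t powi n) 1 \<in> subalgebra_generated (Y_gens t J)"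
    using assms by (auto simp: Y_gens_def intro!: subalgebra_generated.gen)
  with step1 show ?case by (auto simp: Ypow_add intro: subalgebra_generated.mult)
next
  case (step2 k)
  have "Ypow j (t powi n) (-1) \<in> subalgebra_generated (Y_gens t J)"
    using assms by (auto simp: Y_gens_def intro!: subalgebra_generated.gen)
  with step2 show ?case
    using Ypow_add[of j "t powi n" k "-1"] by (auto intro: subalgebra_generated.mult)
qed

lemma monomial_in_subalgebra:
  assumes "keys e \<subseteq> J \<times> range (\<lambda>n::int. t powi n)"
  shows "single e 1 \<in> subalgebra_generated (Y_gens t J)"
proof (rule single_induct_subset[OF assms])
  show "single 0 1 \<in> subalgebra_generated (Y_gens t J)"
    by (simp add: subalgebra_one)
next
  fix x y :: "('a \<times> complex) \<Rightarrow>\<^sub>0 int"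
  assume "single x 1 \<in> subalgebra_generated (Y_gens t J)"
    "single y 1 \<in> subalgebra_generated (Y_gens t J)"
  from subalgebra_generated.mult[OF this]
  show "single (x + y) 1 \<in> subalgebra_generated (Y_gens t J)"
    by (simp add: mult_single)
next
  fix p :: "'a \<times> complex" assume "p \<in> J \<times> range (\<lambda>n::int. t powi n)"
  then show "single (single p (lookup e p)) 1 \<in> subalgebra_generated (Y_gens t J)"
    using Ypow_in_subalgebra[of _ J t] by (auto simp: Ypow_def)
qed

text \<open>All generators are monomials and exponents add under multiplication, so membership can
  be read off the support.\<close>

lemma Y_subalgebra_iff:
  "f \<in> subalgebra_generated (Y_gens t J) \<longleftrightarrow>
     (\<forall>e\<in>keys f. keys e \<subseteq> J \<times> range (\<lambda>n::int. t powi n))"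
proof
  assume "f \<in> subalgebra_generated (Y_gens t J)"
  then show "\<forall>e\<in>keys f. keys e \<subseteq> J \<times> range (\<lambda>n::int. t powi n)"
  proof induction
    case (const c)
    then show ?case by (simp add: const_def)
  next
    case (gen g)
    then show ?case by (auto simp: Y_gens_def Ypow_def split: if_splits)
  next
    case (add f g)
    then show ?case using keys_add[of f g] by blast
  next
    case (mult f g)
    show ?case
    proof
      fix e assume "e \<in> keys (f * g)"
      then obtain a b where "a \<in> keys f" "b \<in> keys g" "e = a + b"
        using keys_mult[of f g] by blast
      then show "keys e \<subseteq> J \<times> range (\<lambda>n::int. t powi n)"
        using mult.IH keys_add[of a b] by blast
    qed
  qed
next
  assume *: "\<forall>e\<in>keys f. keys e \<subseteq> J \<times> range (\<lambda>n::int. t powi n)"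
  have "single e (lookup f e) \<in> subalgebra_generated (Y_gens t J)" if "e \<in> keys f" for e
  proof -
    have "const (lookup f e) * single e 1 \<in> subalgebra_generated (Y_gens t J)"
      using * that by (intro subalgebra_const_times monomial_in_subalgebra) auto
    then show ?thesis by (simp add: const_def mult_single)
  qed
  then have "(\<Sum>e\<in>keys f. single e (lookup f e)) \<in> subalgebra_generated (Y_gens t J)"
    by (rule subalgebra_sum)
  then show "f \<in> subalgebra_generated (Y_gens t J)"
    by (simp flip: poly_mapping_eq_sum_single)
qed

lemma unit_inverse_monomial:
  fixes e :: "'a::ab_group_add"
  shows "unit_inverse (single e (1::'b::comm_ring_1)) = single (- e) 1"
proof -
  have inv: "single e (1::'b) * single (- e) 1 = 1"
    by (simp add: mult_single)
  show ?thesis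
    unfolding unit_inverse_def
  proof (rule the_equality[where a = "single (- e) 1"])
    \<comment> \<open>The definite description requires uniqueness: in a commutative ring an inverse
      is determined by any other one.\<close>
    fix y :: "'a \<Rightarrow>\<^sub>0 'b" assume y: "single e 1 * y = 1"
    have "y = y * (single e 1 * single (- e) 1)" by (simp only: inv mult_1_right)
    also have "\<dots> = single e 1 * y * single (- e) 1" by (simp only: mult_ac)
    finally show "y = single (- e) 1" by (simp only: y mult_1_left)
  qed (rule inv)
qed

section \<open>Spans and bilinear relations\<close>

text \<open>Scalars act through \<open>const\<close>; this makes linear spans of Laurent polynomials
  available.\<close>

interpretation Laurent: vector_space "\<lambda>c (f::'i laurent). const c * f"
  by unfold_locales (simp_all add: algebra_simps const_add const_mult)

section \<open>Multiplication on formal tensors\<close>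

lemma multiplication_map_superset:
  assumes "finite K" "keys w \<subseteq> K"
  shows "multiplication_map w = (\<Sum>p\<in>K. const (lookup w p) * fst p * snd p)"
  unfolding multiplication_map_def
  by (rule sum.mono_neutral_left) (use assms in \<open>auto simp: in_keys_iff\<close>)

lemma multiplication_map_add:
  "multiplication_map (w + w') = multiplication_map w + multiplication_map w'"
  unfolding multiplication_map_def
  by (rule setsum_keys_plus_distrib) (simp_all add: const_add algebra_simps)

lemma multiplication_map_smult:
  "multiplication_map (smult c w) = const c * multiplication_map w"
  unfolding multiplication_map_superset[OF finite_keys keys_smult_subset]
  by (simp add: multiplication_map_def sum_distrib_left mult.assoc)

lemma multiplication_map_zero [simp]: "multiplication_map 0 = 0"
  by (simp add: multiplication_map_def)

lemma multiplication_map_diff: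
  "multiplication_map (w - w') = multiplication_map w - multiplication_map w'"
proof -
  have "multiplication_map (- w') = - multiplication_map w'"
    using multiplication_map_smult[of "- 1" w'] unfolding smult_minus_one const_uminus by simp
  then show ?thesis
    using multiplication_map_add[of w "- w'"] by simp
qed

lemma multiplication_map_single [simp]:
  "multiplication_map (single (u, v) c) = const c * u * v"
  by (simp add: multiplication_map_def)

lemma free_on_zero [simp]: "0 \<in> free_on X"
  by (simp add: free_on_def)

lemma free_on_single: "x \<in> X \<Longrightarrow> single x c \<in> free_on X"
  by (simp add: free_on_def)

lemma free_on_add: "w \<in> free_on X \<Longrightarrow> w' \<in> free_on X \<Longrightarrow> w + w' \<in> free_on X"
  using keys_add[of w w'] by (auto simp: free_on_def)

lemma free_on_diff: "w \<in> free_on X \<Longrightarrow> w' \<in> free_on X \<Longrightarrow> w - w' \<in> free_on X"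
  using keys_minus_subset[of w w'] by (auto simp: free_on_def)

lemma free_on_smult: "w \<in> free_on X \<Longrightarrow> smult c w \<in> free_on X"
  using keys_smult_subset[of c w] by (auto simp: free_on_def)

lemma image_multiplication_map_subset:
  "multiplication_map ` free_on (subalgebra_generated G \<times> subalgebra_generated G') \<subseteq>
     subalgebra_generated (G \<union> G')"
proof -
  have "u \<in> subalgebra_generated (G \<union> G')" if "u \<in> subalgebra_generated G" for u
    by (rule subalgebra_least[OF that]) (auto intro: subalgebra_generated.gen)
  moreover have "u \<in> subalgebra_generated (G \<union> G')" if "u \<in> subalgebra_generated G'" for u
    by (rule subalgebra_least[OF that]) (auto intro: subalgebra_generated.gen)
  ultimately have "multiplication_map w \<in> subalgebra_generated (G \<union> G')"
    if "w \<in> free_on (subalgebra_generated G \<times> subalgebra_generated G')" for w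
    using that unfolding multiplication_map_def free_on_def
    by (intro subalgebra_sum subalgebra_generated.mult subalgebra_generated.const) auto
  then show ?thesis by blast
qed

text \<open>Multiplication is bilinear, so it kills each defining relation; closure of the factors
  under addition and scaling keeps the relations inside the free space.\<close>

lemma bilinear_relations_subset:
  "bilinear_relations (subalgebra_generated G) (subalgebra_generated G') \<subseteq>
     {w \<in> free_on (subalgebra_generated G \<times> subalgebra_generated G'). multiplication_map w = 0}"
proof
  fix w assume "w \<in> bilinear_relations (subalgebra_generated G) (subalgebra_generated G')"
  then show "w \<in> {w \<in> free_on (subalgebra_generated G \<times> subalgebra_generated G').
      multiplication_map w = 0}"
    unfolding bilinear_relations_def Let_def
  proof induction
    case (gen g)
    have "g \<in> free_on (subalgebra_generated G \<times> subalgebra_generated G')"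
      using gen(1)
      by (elim UnE CollectE exE conjE; hypsubst)
        (auto intro!: free_on_diff free_on_single subalgebra_generated.add subalgebra_const_times)
    moreover have "multiplication_map g = 0"
      using gen(1)
      by (elim UnE CollectE exE conjE; hypsubst)
        (simp_all add: multiplication_map_diff distrib_left distrib_right mult_ac)
    ultimately show ?case by simp
  qed (simp_all add: free_on_add free_on_smult multiplication_map_add multiplication_map_smult)
qed

text \<open>
  If products of elements of the spanning sets are linearly independent, the bilinear relations
  are all relations: modulo these, every element of the free space is a combination of pairs of
  spanning elements.
\<close>

lemma bilinear_relations_eqI:
  fixes G G' BU BV :: "'i laurent set"
  defines "U \<equiv> subalgebra_generated G" and "V \<equiv> subalgebra_generated G'"
  assumes U: "U = Laurent.span BU" and V: "V = Laurent.span BV"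
    and indep: "\<And>w. w \<in> free_on (BU \<times> BV) \<Longrightarrow> multiplication_map w = 0 \<Longrightarrow> w = 0"
  shows "{w \<in> free_on (U \<times> V). multiplication_map w = 0} = bilinear_relations U V"
proof
  show "bilinear_relations U V \<subseteq> {w \<in> free_on (U \<times> V). multiplication_map w = 0}"
    unfolding U_def V_def by (rule bilinear_relations_subset)
  define N where "N = bilinear_relations U V"
  have N_add: "x + y \<in> N" if "x \<in> N" "y \<in> N" for x y
    using that unfolding N_def bilinear_relations_def Let_def by (rule submodule_generated.add)
  have N_smult: "smult c x \<in> N" if "x \<in> N" for x c
    using that unfolding N_def bilinear_relations_def Let_def by (blast intro: submodule_generated.scale)
  have N_0: "0 \<in> N"
    unfolding N_def bilinear_relations_def Let_def by (rule submodule_generated.zero)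
  have N1: "single (u + u', v) 1 - single (u, v) 1 - single (u', v) 1 \<in> N"
    if "u \<in> U" "u' \<in> U" "v \<in> V" for u u' v
    using that unfolding N_def bilinear_relations_def Let_def
    by (intro submodule_generated.gen) blast
  have N2: "single (u, v + v') 1 - single (u, v) 1 - single (u, v') 1 \<in> N"
    if "u \<in> U" "v \<in> V" "v' \<in> V" for u v v'
    using that unfolding N_def bilinear_relations_def Let_def
    by (intro submodule_generated.gen) blast
  have N3: "single (const c * u, v) 1 - smult c (single (u, v) 1) \<in> N"
    if "u \<in> U" "v \<in> V" for c u v
    using that unfolding N_def bilinear_relations_def Let_def
    by (intro submodule_generated.gen) blast
  have N4: "single (u, const c * v) 1 - smult c (single (u, v) 1) \<in> N"
    if "u \<in> U" "v \<in> V" for c u v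
    using that unfolding N_def bilinear_relations_def Let_def
    by (intro submodule_generated.gen) blast
  \<comment> \<open>Formal tensors congruent modulo \<open>N\<close> to a combination of pairs of
    spanning elements; the goal is that \<open>Q\<close> contains all formal tensors.\<close>
  define Q where "Q = {x + y | x y. x \<in> free_on (BU \<times> BV) \<and> y \<in> N}"
  have Q_I: "x + y \<in> Q" if "x \<in> free_on (BU \<times> BV)" "y \<in> N" for x y
    using that unfolding Q_def by blast
  have Q_N: "y \<in> Q" if "y \<in> N" for y
    using Q_I[OF free_on_zero that] by simp
  have Q_add: "x + y \<in> Q" if xy: "x \<in> Q" "y \<in> Q" for x y
  proof -
    obtain a b a' b' where *: "a \<in> free_on (BU \<times> BV)" "b \<in> N" "x = a + b"
      "a' \<in> free_on (BU \<times> BV)" "b' \<in> N" "y = a' + b'"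
      using xy unfolding Q_def by blast
    have "(a + a') + (b + b') \<in> Q" using * by (intro Q_I free_on_add N_add)
    then show ?thesis using * by (simp add: algebra_simps)
  qed
  have Q_smult: "smult c x \<in> Q" if x: "x \<in> Q" for c x
  proof -
    obtain a b where "a \<in> free_on (BU \<times> BV)" "b \<in> N" "x = a + b"
      using x unfolding Q_def by blast
    then show ?thesis by (auto simp: smult_add_right intro: Q_I free_on_smult N_smult)
  qed
  have Q_congr: "x \<in> Q" if "x - y \<in> N" "y \<in> Q" for x y
    using Q_add[OF Q_N[OF that(1)] that(2)] by simp
  have step_left: "single (const c * u + u', v) 1 \<in> Q"
    if "u \<in> U" "u' \<in> U" "v \<in> V" "single (u, v) 1 \<in> Q" "single (u', v) 1 \<in> Q" for c u u' v
  proof (rule Q_congr)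
    have "const c * u \<in> U" using that by (simp add: U_def subalgebra_const_times)
    then show "single (const c * u + u', v) 1
        - (single (const c * u, v) 1 + single (u', v) 1) \<in> N"
      using N1[of "const c * u" u' v] that by (simp add: algebra_simps)
    show "single (const c * u, v) 1 + single (u', v) 1 \<in> Q"
      using that by (intro Q_add Q_congr[OF N3] Q_smult)
  qed
  have step_right: "single (u, const c * v + v') 1 \<in> Q"
    if "u \<in> U" "v \<in> V" "v' \<in> V" "single (u, v) 1 \<in> Q" "single (u, v') 1 \<in> Q" for c u v v'
  proof (rule Q_congr)
    have "const c * v \<in> V" using that by (simp add: V_def subalgebra_const_times)
    then show "single (u, const c * v + v') 1
        - (single (u, const c * v) 1 + single (u, v') 1) \<in> N"
      using N2[of u "const c * v" v'] that by (simp add: algebra_simps)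
    show "single (u, const c * v) 1 + single (u, v') 1 \<in> Q"
      using that by (intro Q_add Q_congr[OF N4] Q_smult)
  qed
  have U_lin: "const c * x + y \<in> U" if "x \<in> U" "y \<in> U" for c x y
    using that unfolding U_def by (intro subalgebra_generated.add subalgebra_const_times)
  have V_lin: "const c * x + y \<in> V" if "x \<in> V" "y \<in> V" for c x y
    using that unfolding V_def by (intro subalgebra_generated.add subalgebra_const_times)
  have U0: "0 \<in> U" and V0: "0 \<in> V" by (simp_all add: U_def V_def subalgebra_zero)
  \<comment> \<open>The scaling relation with c = 0 already puts the pair (0, v) into
    \<open>N\<close>.\<close>
  have zero_left: "single (0, v) 1 \<in> Q" if "v \<in> V" for v
    using N3[of 0 v 0] that U0 by (intro Q_N) simp
  have zero_right: "single (u, 0) 1 \<in> Q" if "u \<in> U" for u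
    using N4[of u 0 0] that V0 by (intro Q_N) simp
  have BU: "b \<in> U" if "b \<in> BU" for b using that unfolding U by (rule Laurent.span_base)
  have BV: "b \<in> V" if "b \<in> BV" for b using that unfolding V by (rule Laurent.span_base)
  \<comment> \<open>One argument at a time: first the right one, against a spanning element on the
    left, then the left one. Membership in \<open>V\<close> is carried through the induction because
    \<open>step_right\<close> asks for it.\<close>
  have 1: "v \<in> V \<and> single (b, v) 1 \<in> Q" if b: "b \<in> BU" and v: "v \<in> V" for b v
    using v[unfolded V]
  proof (induction rule: Laurent.span_induct_alt)
    case base
    then show ?case using zero_right BU b V0 by blast
  next
    case (step c x y)
    have "single (b, x) 1 \<in> Q"
      using Q_I[OF free_on_single[of "(b, x)" "BU \<times> BV"] N_0] b step.hyps by simp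
    with step show ?case
      using step_right[of b x y c] BU[OF b] BV V_lin[of x y c] by blast
  qed
  have 2: "u \<in> U \<and> single (u, v) 1 \<in> Q" if v: "v \<in> V" and u: "u \<in> U" for u v
    using u[unfolded U]
  proof (induction rule: Laurent.span_induct_alt)
    case base
    then show ?case using zero_left v U0 by blast
  next
    case (step c x y)
    then show ?case
      using step_left[of x y v c] 1[of x v] BU v U_lin[of x y c] by blast
  qed
  show "{w \<in> free_on (U \<times> V). multiplication_map w = 0} \<subseteq> N"
  proof
    fix w assume "w \<in> {w \<in> free_on (U \<times> V). multiplication_map w = 0}"
    then have w: "keys w \<subseteq> U \<times> V" "multiplication_map w = 0" by (auto simp: free_on_def)
    have "w \<in> Q"
    proof (rule single_induct_subset[OF w(1), where P = "\<lambda>w. w \<in> Q"])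
      fix p assume "p \<in> U \<times> V"
      then have "smult (lookup w p) (single p 1) \<in> Q" using 2 by (intro Q_smult) auto
      then show "single p (lookup w p) \<in> Q" by simp
    qed (use Q_N N_0 Q_add in auto)
    then obtain x y where xy: "x \<in> free_on (BU \<times> BV)" "y \<in> N" "w = x + y"
      unfolding Q_def by blast
    have "multiplication_map y = 0"
      using xy(2) bilinear_relations_subset[of G G'] by (auto simp: N_def U_def V_def)
    then have "multiplication_map x = 0"
      using w(2) xy(3) by (simp add: multiplication_map_add)
    with indep xy(1) have "x = 0" by blast
    with xy(2,3) show "w \<in> N" by simp
  qed
qed

section \<open>The kernel of the lifted derivation\<close>

lemma prod_single: "(\<Prod>x\<in>X. single (e x) 1) = single (sum e X) (1::'b::comm_ring_1)"
  for e :: "'x \<Rightarrow> 'a::comm_monoid_add"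
  by (induction X rule: infinite_finite_induct) (simp_all add: mult_single)

section \<open>Cosets and uniqueness of the screening operator\<close>

lemma submodule_uminus:
  assumes "- 1 \<in> R" "x \<in> submodule_generated R G"
  shows "- x \<in> submodule_generated R G"
  using submodule_generated.scale[OF assms] by (simp add: smult_minus_one)

text \<open>\<open>submodule_generated\<close> is closed only under addition and scaling by
  \<open>R\<close>; the scalar -1 supplies the differences needed for the usual criterion.\<close>

lemma coset_eq_iff:
  assumes "- 1 \<in> R"
  shows "x +o submodule_generated R G = y +o submodule_generated R G \<longleftrightarrow>
     x - y \<in> submodule_generated R G"
proof
  assume "x +o submodule_generated R G = y +o submodule_generated R G"
  moreover have "x \<in> x +o submodule_generated R G"
    using submodule_generated.zero[of R G] by (force simp: elt_set_plus_def)
  ultimately show "x - y \<in> submodule_generated R G"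
    by (auto simp: elt_set_plus_def)
next
  assume xy: "x - y \<in> submodule_generated R G"
  have "y - x \<in> submodule_generated R G"
    using submodule_uminus[OF assms xy] by simp
  have sub: "a +o submodule_generated R G \<subseteq> b +o submodule_generated R G"
    if ab: "a - b \<in> submodule_generated R G" for a b
  proof
    fix z assume "z \<in> a +o submodule_generated R G"
    then obtain n where n: "n \<in> submodule_generated R G" "z = a + n"
      by (auto simp: elt_set_plus_def)
    have "b + ((a - b) + n) \<in> b +o submodule_generated R G"
      using submodule_generated.add[OF ab n(1)] by (rule set_plus_intro2)
    then show "z \<in> b +o submodule_generated R G" by (simp add: n(2))
  qed
  show "x +o submodule_generated R G = y +o submodule_generated R G"
    using sub[OF xy] sub[OF \<open>y - x \<in> _\<close>] by blast
qed

text \<open>Replaces an abstract operator with coset values by the explicit derivation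
  \<open>S_lift\<close>; \<open>screening_kernel_eq_lifted_kernel\<close> identifies the two
  kernels.\<close>

definition lifted_kernel ::
    "('i::finite \<Rightarrow> 'i \<Rightarrow> int) \<Rightarrow> complex \<Rightarrow> 'i \<Rightarrow> 'i laurent set" where
  "lifted_kernel C t i = {f \<in> Y_algebra t. S_lift i f \<in> S_relations C t i}"

lemma const_in_Y_algebra: "const c \<in> Y_algebra t"
  unfolding Y_algebra_def by (rule subalgebra_generated.const)

lemma minus_one_in_Y_algebra: "- 1 \<in> Y_algebra t"
  using const_in_Y_algebra[of "- 1" t] by (simp add: const_uminus)

text \<open>A derivation is determined by its values on algebra generators, and
  \<open>S_lift\<close> modulo the relations takes the prescribed ones.\<close>

lemma screening_operator_eq_S_lift:
  fixes C :: "'i::finite \<Rightarrow> 'i \<Rightarrow> int"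
  assumes S: "screening_operator C t i S" and f: "f \<in> Y_algebra t"
  shows "S f = S_lift i f +o S_relations C t i"
proof -
  define N where "N = S_relations C t i"
  note N_eq = N_def[unfolded S_relations_def]
  have N: "N + N = N"
    unfolding N_eq by (rule submodule_generated_set_plus)
  have sm: "coset_smult N r (m +o N) = smult r m +o N" if "r \<in> Y_algebra t" for r m
    by (rule coset_smult_coset[OF _ that]) (simp add: N_eq)
  have coset_eq: "x +o N = y +o N \<longleftrightarrow> x - y \<in> N" for x y
    unfolding N_eq by (rule coset_eq_iff[OF minus_one_in_Y_algebra])
  have S_quot: "S f \<in> S_quotient C t i" if "f \<in> Y_algebra t" for f
    using S that by (simp add: screening_operator_def Let_def)
  have S_add: "S (f + g) = S f + S g" if "f \<in> Y_algebra t" "g \<in> Y_algebra t" for f g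
    using S that by (simp add: screening_operator_def Let_def)
  have S_const: "S (const c * f) = coset_smult N (const c) (S f)" if "f \<in> Y_algebra t" for c f
    using S that by (simp add: screening_operator_def Let_def N_def)
  have S_mult: "S (f * g) = coset_smult N f (S g) + coset_smult N g (S f)"
    if "f \<in> Y_algebra t" "g \<in> Y_algebra t" for f g
    using S that by (simp add: screening_operator_def Let_def N_def)
  have S_Y: "S (Ypow j (t powi n) s) =
      smult (of_int (s * (if i = j then 1 else 0)) * Ypow j (t powi n) s) (S_sym (t powi n)) +o N"
    if "s \<in> {1, -1}" for j n s
    using S that unfolding screening_operator_def Let_def N_def by blast
  have one: "1 \<in> Y_algebra t"
    unfolding Y_algebra_def by (rule subalgebra_one)
  \<comment> \<open>The Leibniz rule for 1 * 1 gives \<open>S 1 = S 1 + S 1\<close>.\<close>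
  have S_1: "S 1 = 0 +o N"
  proof -
    obtain x where x: "S 1 = x +o N"
      using S_quot[OF one] by (auto simp: S_quotient_def N_def)
    have "smult 1 x = x" by (rule poly_mapping_eqI) simp
    then have "S 1 = (x + x) +o N"
      using S_mult[OF one one] unfolding x sm[OF one] coset_plus[OF N] by (simp add: x)
    then have "x \<in> N" using coset_eq[of "x + x" x] x by simp
    then show ?thesis using coset_eq[of x 0] x by simp
  qed
  have "S f = S_lift i f +o N"
    using f unfolding Y_algebra_def
  proof induction
    case (const c)
    have "S (const c * 1) = 0 +o N"
      unfolding S_const[OF one] S_1 sm[OF const_in_Y_algebra] by (simp only: smult_zero_right)
    then show ?case by simp
  next
    case (gen g)
    then obtain j n s where g: "g = Ypow j (t powi n) s" "s \<in> {1, -1}"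
      by (auto simp: Y_gens_def)
    show ?case unfolding g(1) S_Y[OF g(2)] S_lift_Ypow ..
  next
    case (add f g)
    then show ?case
      by (simp only: S_add[unfolded Y_algebra_def] coset_plus[OF N] S_lift_add)
  next
    case (mult f g)
    then show ?case
      by (simp only: S_mult[unfolded Y_algebra_def] sm[unfolded Y_algebra_def]
          coset_plus[OF N] S_lift_mult)
  qed
  then show ?thesis by (simp add: N_def)
qed

lemma screening_kernel_eq_lifted_kernel:
  assumes S: "screening_operator C t i S"
  shows "screening_kernel C t i S = lifted_kernel C t i"
proof -
  have "S_lift i f +o S_relations C t i = S_relations C t i \<longleftrightarrow> S_lift i f \<in> S_relations C t i" for f
    using coset_eq_iff[OF minus_one_in_Y_algebra, of "S_lift i f" t _ 0]
    by (simp add: S_relations_def)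
  then show ?thesis
    by (simp add: screening_kernel_def lifted_kernel_def screening_operator_eq_S_lift[OF S]
        cong: conj_cong)
qed

lemma lifted_kernel_const: "const c \<in> lifted_kernel C t i"
  by (simp add: lifted_kernel_def const_in_Y_algebra S_relations_def submodule_generated.zero)

lemma lifted_kernel_add:
  assumes "f \<in> lifted_kernel C t i" "g \<in> lifted_kernel C t i"
  shows "f + g \<in> lifted_kernel C t i"
  using assms
  by (auto simp: lifted_kernel_def S_relations_def Y_algebra_def S_lift_add
      intro: subalgebra_generated.add submodule_generated.add)

text \<open>By the Leibniz rule: both factors lie in \<open>Y_algebra t\<close>, whose elements are
  the scalars allowed in the relation module.\<close>

lemma lifted_kernel_mult:
  assumes "f \<in> lifted_kernel C t i" "g \<in> lifted_kernel C t i"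
  shows "f * g \<in> lifted_kernel C t i"
  using assms
  by (auto simp: lifted_kernel_def S_relations_def Y_algebra_def S_lift_mult
      intro: subalgebra_generated.mult submodule_generated.add submodule_generated.scale)

lemma lifted_kernel_diff:
  assumes "f \<in> lifted_kernel C t i" "g \<in> lifted_kernel C t i"
  shows "f - g \<in> lifted_kernel C t i"
  using lifted_kernel_add[OF assms(1) lifted_kernel_mult[OF lifted_kernel_const[of "- 1"] assms(2)]]
  by (simp add: const_uminus)

lemma subalgebra_subset_lifted_kernel:
  assumes "G \<subseteq> lifted_kernel C t i"
  shows "subalgebra_generated G \<subseteq> lifted_kernel C t i"
proof
  fix f assume "f \<in> subalgebra_generated G"
  then show "f \<in> lifted_kernel C t i"
    by induction
      (use assms in \<open>auto intro: lifted_kernel_const lifted_kernel_add lifted_kernel_mult\<close>)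
qed

section \<open>The proposed generators lie in the kernel\<close>

locale generic_screening =
  fixes C :: "'i::finite \<Rightarrow> 'i \<Rightarrow> int" and t :: complex and i :: 'i
  assumes t_nonzero: "t \<noteq> 0" and t_not_root: "\<And>n::nat. n > 0 \<Longrightarrow> t ^ n \<noteq> 1"
begin

text \<open>Equality of two different powers would make a positive power of \<open>t\<close> equal
  to 1.\<close>

lemma t_powi_eq_iff [simp]: "t powi m = t powi n \<longleftrightarrow> m = n"
proof -
  have less: "t powi m \<noteq> t powi n" if "m < n" for m n
  proof
    assume "t powi m = t powi n"
    then have "t powi (n - m) = 1"
      using t_nonzero by (simp add: power_int_diff)
    then have "t ^ nat (n - m) = 1" using that by (simp add: power_int_def)
    then show False using t_not_root[of "nat (n - m)"] that by simp
  qed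
  show ?thesis using less[of m n] less[of n m] by (cases m n rule: linorder_cases) auto
qed

text \<open>Discrete logarithm to base \<open>t\<close>, meaningful only on powers of
  \<open>t\<close>.\<close>

definition idx :: "complex \<Rightarrow> int" where
  "idx a = (THE n. a = t powi n)"

lemma idx_powi [simp]: "idx (t powi n) = n"
  unfolding idx_def by (rule the_equality) (auto dest: sym)

abbreviation var :: "int \<Rightarrow> ('i \<times> complex) \<Rightarrow>\<^sub>0 int" where
  "var n \<equiv> single (i, t powi n) 1"

definition Aexp :: "int \<Rightarrow> ('i \<times> complex) \<Rightarrow>\<^sub>0 int" where
  "Aexp n = var (n + 1) + var (n - 1) +
     (\<Sum>j\<in>UNIV - {i}. single (j, t powi n) (- incidence_matrix C j i))"

lemma A_eq: "A C t i n = single (Aexp n) 1"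
  by (simp add: A_def Aexp_def Ypow_def prod_single mult_single)

lemma lookup_Aexp:
  "lookup (Aexp n) (i, a) =
     (if a = t powi (n + 1) then 1 else 0) + (if a = t powi (n - 1) then 1 else 0)"
proof -
  have "(\<Sum>j\<in>UNIV - {i}. lookup (single (j, t powi n) (- incidence_matrix C j i)) (i, a)) = 0"
    by (rule sum.neutral) (auto simp: lookup_single when_def)
  then show ?thesis
    by (simp add: Aexp_def lookup_add lookup_sum lookup_single when_def)
qed

lemma keys_Aexp: "keys (Aexp n) \<subseteq> UNIV \<times> range (\<lambda>n::int. t powi n)"
proof -
  have "keys (\<Sum>j\<in>UNIV - {i}. single (j, t powi n) (- incidence_matrix C j i)) \<subseteq>
      UNIV \<times> range (\<lambda>n::int. t powi n)"
    by (rule order_trans[OF keys_sum]) (auto split: if_splits)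
  moreover have "keys (var k) \<subseteq> UNIV \<times> range (\<lambda>n::int. t powi n)" for k
    by auto
  ultimately show ?thesis
    unfolding Aexp_def by (intro order_trans[OF keys_add] Un_least)
qed

definition T :: "int \<Rightarrow> 'i laurent" where
  "T n = Ypow i (t powi n) 1 * (1 + unit_inverse (A C t i (n + 1)))"

lemma T_gens_eq: "T_gens C t i = range T"
  by (auto simp: T_gens_def T_def)

lemma T_eq: "T n = single (var n) 1 + single (var n - Aexp (n + 1)) 1"
  by (simp add: T_def A_eq unit_inverse_monomial Ypow_def distrib_left mult_single)

text \<open>The second term of \<open>T n\<close> contains no Y_i except Y_i(zt^(n+2))^(-1), so its
  derivative is a multiple of the symbol of index n+2. The first term is A_i(zt^(n+1)) times the
  second. Together they give a multiple of one defining relation.\<close>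

lemma S_lift_T:
  "S_lift i (T n) = - smult (single (var n - Aexp (n + 1)) 1)
     (S_sym (t powi (n + 2)) - smult (A C t i (n + 1)) (S_sym (t powi n)))"
proof (rule poly_mapping_eqI)
  fix a
  have "n + 1 + 1 = n + 2" by simp
  then show "lookup (S_lift i (T n)) a = lookup (- smult (single (var n - Aexp (n + 1)) 1)
     (S_sym (t powi (n + 2)) - smult (A C t i (n + 1)) (S_sym (t powi n)))) a"
    by (auto simp: T_eq S_lift_add lookup_add lookup_S_lift_single lookup_minus lookup_Aexp
        S_sym_def lookup_single when_def A_eq mult_single single_uminus)
qed

lemma T_in_lifted_kernel: "T n \<in> lifted_kernel C t i"
proof -
  have k: "keys (var n) \<subseteq> UNIV \<times> range (\<lambda>n::int. t powi n)" by auto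
  have "keys (var n - Aexp (n + 1)) \<subseteq> UNIV \<times> range (\<lambda>n::int. t powi n)"
    using keys_minus_subset[of "var n" "Aexp (n + 1)"] keys_Aexp[of "n + 1"] k by blast
  then have m: "single (var n - Aexp (n + 1)) 1 \<in> Y_algebra t"
    unfolding Y_algebra_def by (rule monomial_in_subalgebra)
  have "T n \<in> Y_algebra t"
    using m monomial_in_subalgebra[OF k] unfolding T_eq Y_algebra_def
    by (intro subalgebra_generated.add)
  moreover have "S_lift i (T n) \<in> S_relations C t i"
    unfolding S_lift_T S_relations_def
    by (intro submodule_uminus[OF minus_one_in_Y_algebra] submodule_generated.scale m
        submodule_generated.gen) blast
  ultimately show ?thesis by (simp add: lifted_kernel_def)
qed

lemma Y_gens_subset_lifted_kernel: "Y_gens t (UNIV - {i}) \<subseteq> lifted_kernel C t i"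
proof
  fix f assume "f \<in> Y_gens t (UNIV - {i})"
  then obtain j n s where f: "f = Ypow j (t powi n) s" "j \<noteq> i" "s \<in> {1, -1}"
    by (auto simp: Y_gens_def)
  then have "f \<in> Y_algebra t"
    unfolding Y_algebra_def by (auto simp: Y_gens_def intro!: subalgebra_generated.gen)
  moreover have "S_lift i f = 0" using f by (simp add: S_lift_Ypow)
  ultimately show "f \<in> lifted_kernel C t i"
    by (simp add: lifted_kernel_def S_relations_def submodule_generated.zero)
qed

lemma subalgebra_le_lifted_kernel:
  "subalgebra_generated (Y_gens t (UNIV - {i}) \<union> T_gens C t i) \<subseteq> lifted_kernel C t i"
  by (rule subalgebra_subset_lifted_kernel)
    (use Y_gens_subset_lifted_kernel T_in_lifted_kernel in \<open>auto simp: T_gens_eq\<close>)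

section \<open>Dominant monomials\<close>

text \<open>
  The quotient module embeds into two copies of the Laurent polynomials, one for each parity of
  the index: the symbol of index \<open>n\<close> goes to the monomial with exponent \<open>Uexp n\<close>.
\<close>

definition Uexp :: "int \<Rightarrow> ('i \<times> complex) \<Rightarrow>\<^sub>0 int" where
  "Uexp = (SOME u. \<forall>n. u (n + 2) = u n + Aexp (n + 1))"

lemma Uexp_step: "Uexp (n + 2) = Uexp n + Aexp (n + 1)"
proof -
  obtain u where "\<And>n. u (n + 2) = u n + Aexp (n + 1)"
    using exists_two_step_solution[of "\<lambda>n. Aexp (n + 1)"] by blast
  then have "\<exists>u. \<forall>n. u (n + 2) = u n + Aexp (n + 1)" by blast
  from someI_ex[OF this] show ?thesis by (simp add: Uexp_def)
qed

text \<open>The difference telescopes to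
  \<open>Aexp (m + 1) + Aexp (m + 3) + ... + Aexp (n - 1)\<close>. Among the Y_i in it the lowest
  index is m, and it occurs only in the first summand.\<close>

lemma lookup_Uexp_diff:
  assumes "m < n" "even (n - m)"
  shows "lookup (Uexp n - Uexp m) (i, t powi m) = 1"
    and "k < m \<Longrightarrow> lookup (Uexp n - Uexp m) (i, t powi k) = 0"
proof -
  \<comment> \<open>Equal parity and m < n give a distance of at least 2, hence
    \<open>Suc l\<close>.\<close>
  have *: "lookup (Uexp (m + 2 * int (Suc l)) - Uexp m) (i, t powi m) = 1 \<and>
      (k < m \<longrightarrow> lookup (Uexp (m + 2 * int (Suc l)) - Uexp m) (i, t powi k) = 0)" for l
  proof (induction l)
    case 0
    then show ?case by (simp add: Uexp_step lookup_Aexp)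
  next
    case (Suc l)
    have "m + 2 * int (Suc (Suc l)) = m + 2 * int (Suc l) + 2" by simp
    then have "Uexp (m + 2 * int (Suc (Suc l))) - Uexp m =
        (Uexp (m + 2 * int (Suc l)) - Uexp m) + Aexp (m + 2 * int (Suc l) + 1)"
      by (simp only: Uexp_step) (simp add: algebra_simps)
    with Suc show ?case by (simp only: lookup_add lookup_Aexp) simp
  qed
  obtain c where c: "n - m = 2 * c" using assms(2) by blast
  then have "n = m + 2 * int (Suc (nat (c - 1)))" using assms(1) by simp
  with *[of "nat (c - 1)"]
  show "lookup (Uexp n - Uexp m) (i, t powi m) = 1"
    and "k < m \<Longrightarrow> lookup (Uexp n - Uexp m) (i, t powi k) = 0" by simp_all
qed

text \<open>The recursion for \<open>W\<close> is what makes its linear extension descend to the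
  quotient module.\<close>

lemma extend_relations_eq_zero:
  assumes "\<And>m. W (t powi (m + 2)) = A C t i (m + 1) * W (t powi m)"
    and "x \<in> S_relations C t i"
  shows "extend W x = 0"
  using assms(2) unfolding S_relations_def
  by induction (auto simp: extend_add extend_diff extend_smult S_sym_def assms(1))

text \<open>Compare coefficients at \<open>e + Uexp n\<close> in the image of
  \<open>S_lift i f\<close>, which is zero. The symbol of index m contributes the coefficient of
  \<open>f\<close> at \<open>e + Uexp n - Uexp m\<close>; by assumption only m = n survives.\<close>

lemma lifted_kernel_coefficient:
  assumes f: "f \<in> lifted_kernel C t i"
    and others: "\<And>m. m \<noteq> n \<Longrightarrow> even (m - n) \<Longrightarrow> e + Uexp n - Uexp m \<notin> keys f"
  shows "lookup e (i, t powi n) = 0 \<or> lookup f e = 0"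
proof -
  \<comment> \<open>Projection to the copy belonging to the parity of \<open>n\<close>; all other
    symbols go to 0.\<close>
  define W :: "complex \<Rightarrow> 'i laurent" where
    "W a = (if \<exists>m. a = t powi m \<and> even (m - n) then single (Uexp (idx a)) 1 else 0)" for a
  have "W (t powi (m + 2)) = A C t i (m + 1) * W (t powi m)" for m
    by (simp add: W_def A_eq mult_single Uexp_step add.commute)
  then have "extend W (S_lift i f) = 0"
    using f by (intro extend_relations_eq_zero) (auto simp: lifted_kernel_def)
  then have "0 = (\<Sum>a\<in>keys (S_lift i f). lookup (W a * lookup (S_lift i f) a) (e + Uexp n))"
    by (simp add: extend_def mult.commute flip: lookup_sum)
  also have "\<dots> = (\<Sum>a\<in>keys (S_lift i f).
      if a = t powi n then of_int (lookup e (i, t powi n)) * lookup f e else 0)"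
  proof (rule sum.cong[OF refl])
    fix a
    show "lookup (W a * lookup (S_lift i f) a) (e + Uexp n) =
        (if a = t powi n then of_int (lookup e (i, t powi n)) * lookup f e else 0)"
    proof (cases "\<exists>m. a = t powi m \<and> even (m - n)")
      case True
      then obtain m where m: "a = t powi m" "even (m - n)" by blast
      have "e + Uexp n = Uexp m + (e + Uexp n - Uexp m)" by simp
      then have "lookup (W a * lookup (S_lift i f) a) (e + Uexp n) =
          of_int (lookup (e + Uexp n - Uexp m) (i, a)) * lookup f (e + Uexp n - Uexp m)"
        using m lookup_single_times[of "Uexp m" 1 "lookup (S_lift i f) a" "e + Uexp n - Uexp m"]
        by (auto simp: W_def lookup_S_lift)
      then show ?thesis
        using others[of m] m by (cases "m = n") (auto simp: in_keys_iff)
    next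
      case False
      then have "a \<noteq> t powi n" by auto
      moreover have "W a = 0" using False by (simp only: W_def if_False)
      ultimately show ?thesis by simp
    qed
  qed
  also have "\<dots> = (if t powi n \<in> keys (S_lift i f)
      then of_int (lookup e (i, t powi n)) * lookup f e else 0)"
    by simp
  finally have "t powi n \<in> keys (S_lift i f) \<Longrightarrow>
      of_int (lookup e (i, t powi n)) * lookup f e = 0" by simp
  \<comment> \<open>Outside the support the sum above is empty, but there the product is itself a
    coefficient of \<open>S_lift i f\<close>, hence zero.\<close>
  moreover have "of_int (lookup e (i, t powi n)) * lookup f e = 0"
    if "t powi n \<notin> keys (S_lift i f)"
    using that lookup_S_lift[of i f "t powi n" e] by (simp add: in_keys_iff)
  ultimately show ?thesis by auto
qed

definition dominant :: "(('i \<times> complex) \<Rightarrow>\<^sub>0 int) \<Rightarrow> bool" where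
  "dominant e \<longleftrightarrow> (\<forall>n. lookup e (i, t powi n) \<ge> 0)"

text \<open>Distinct exponent vectors may agree at every Y_i, so this is only a strict partial
  order; it yields maximal elements rather than a greatest one.\<close>

definition lex_less :: "(('i \<times> complex) \<Rightarrow>\<^sub>0 int) \<Rightarrow> (('i \<times> complex) \<Rightarrow>\<^sub>0 int) \<Rightarrow> bool" where
  "lex_less d e \<longleftrightarrow> (\<exists>n. lookup d (i, t powi n) < lookup e (i, t powi n) \<and>
     (\<forall>k<n. lookup d (i, t powi k) = lookup e (i, t powi k)))"

lemma lex_less_trans:
  assumes "lex_less d e" "lex_less e f"
  shows "lex_less d f"
proof -
  obtain m n where "lookup d (i, t powi m) < lookup e (i, t powi m)"
      "\<forall>k<m. lookup d (i, t powi k) = lookup e (i, t powi k)"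
      "lookup e (i, t powi n) < lookup f (i, t powi n)"
      "\<forall>k<n. lookup e (i, t powi k) = lookup f (i, t powi k)"
    using assms unfolding lex_less_def by blast
  then show ?thesis
    unfolding lex_less_def by (intro exI[of _ "min m n"]) (cases m n rule: linorder_cases; auto)
qed

lemma lex_less_irrefl: "\<not> lex_less e e"
  by (auto simp: lex_less_def)

text \<open>
  A lexicographically maximal monomial is dominant.  If its exponent at \<open>n\<close> were negative, take
  among the monomials with the same exponents below \<open>n\<close> and a negative exponent at \<open>n\<close> one whose
  exponent at \<open>n\<close> is smallest.  In the coefficient equation belonging to it, indices below \<open>n\<close>
  contribute lexicographically larger monomials and indices above \<open>n\<close> monomials with a smaller
  exponent at \<open>n\<close>, so only a nonzero term is left.
\<close>

lemma exists_dominant: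
  assumes f: "f \<in> lifted_kernel C t i" "f \<noteq> 0"
  shows "\<exists>e\<in>keys f. dominant e"
proof -
  have "\<exists>e\<in>keys f. \<forall>d\<in>keys f. d \<noteq> e \<longrightarrow> \<not> lex_less e d"
  proof (rule Finite_Set.bex_max_element)
    show "asymp_on (keys f) lex_less"
      using lex_less_trans lex_less_irrefl by (auto intro!: asymp_onI)
    show "transp_on (keys f) lex_less"
      using lex_less_trans by (auto intro!: transp_onI)
  qed (use f in auto)
  then obtain e where e: "e \<in> keys f" and max: "\<And>d. d \<in> keys f \<Longrightarrow> \<not> lex_less e d"
    using lex_less_irrefl by metis
  have "lookup e (i, t powi n) \<ge> 0" for n
  proof (rule ccontr)
    assume neg: "\<not> 0 \<le> lookup e (i, t powi n)"
    define P where "P = {d \<in> keys f. (\<forall>k<n. lookup d (i, t powi k) = lookup e (i, t powi k)) \<and>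
      lookup d (i, t powi n) < 0}"
    have "finite P" "P \<noteq> {}" using e neg by (auto simp: P_def)
    then obtain d where d: "d \<in> P"
      and min: "\<And>d'. d' \<in> P \<Longrightarrow> lookup d (i, t powi n) \<le> lookup d' (i, t powi n)"
      using arg_min_if_finite[of P "\<lambda>d. lookup d (i, t powi n)"] by (meson not_less)
    have d': "d \<in> keys f" "\<And>k. k < n \<Longrightarrow> lookup d (i, t powi k) = lookup e (i, t powi k)"
      "lookup d (i, t powi n) < 0"
      using d by (auto simp: P_def)
    have "d + Uexp n - Uexp m \<notin> keys f" if m: "m \<noteq> n" "even (m - n)" for m
    proof
      assume *: "d + Uexp n - Uexp m \<in> keys f"
      show False
      proof (cases "m < n")
        case True
        \<comment> \<open>The shift \<open>Uexp n - Uexp m\<close> adds 1 at index m and nothing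
          below it, and \<open>d\<close> agrees with \<open>e\<close> at these indices.\<close>
        then have "lex_less e (d + Uexp n - Uexp m)"
          unfolding lex_less_def
          using lookup_Uexp_diff[of m n] m d'(2)
          by (intro exI[of _ m]) (auto simp: lookup_add lookup_minus)
        then show False using max * by blast
      next
        case False
        then have "n < m" using m by simp
        \<comment> \<open>Now the shift subtracts 1 at index n and changes nothing below it.\<close>
        with lookup_Uexp_diff[of n m] m d' *
        have "d + Uexp n - Uexp m \<in> P"
          "lookup (d + Uexp n - Uexp m) (i, t powi n) = lookup d (i, t powi n) - 1"
          by (auto simp: P_def lookup_add lookup_minus)
        then show False using min by fastforce
      qed
    qed
    then show False
      using lifted_kernel_coefficient[OF f(1), of n d] d'(1,3) by (auto simp: in_keys_iff)
  qed
  then show ?thesis using e by (auto simp: dominant_def)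
qed

section \<open>Leading terms\<close>

definition deg :: "(('i \<times> complex) \<Rightarrow>\<^sub>0 int) \<Rightarrow> int" where
  "deg = extend (\<lambda>p. if fst p = i then 1 else 0)"

lemma deg_add: "deg (d + e) = deg d + deg e"
  by (simp add: deg_def extend_add)

lemma deg_diff: "deg (d - e) = deg d - deg e"
  by (simp add: deg_def extend_diff)

lemma deg_single: "deg (single p c) = (if fst p = i then c else 0)"
  by (simp add: deg_def)

text \<open>Consequently the two terms of \<open>T n\<close> have degrees 1 and -1.\<close>

lemma deg_Aexp: "deg (Aexp n) = 2"
proof -
  have "deg (\<Sum>j\<in>UNIV - {i}. single (j, t powi n) (- incidence_matrix C j i)) = 0"
    unfolding deg_def extend_sum by (rule sum.neutral) auto
  then show ?thesis by (simp add: Aexp_def deg_add deg_single)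
qed

text \<open>A monic leading term in a strong sense: \<open>d\<close> is the only monomial of
  \<open>f\<close> of degree at least \<open>deg d\<close>.\<close>

definition has_lead :: "'i laurent \<Rightarrow> (('i \<times> complex) \<Rightarrow>\<^sub>0 int) \<Rightarrow> bool" where
  "has_lead f d \<longleftrightarrow> (\<forall>e\<in>keys (f - single d 1). deg e < deg d)"

lemma lookup_has_lead:
  assumes "has_lead f d" "deg d \<le> deg e"
  shows "lookup f e = (if e = d then 1 else 0)"
proof -
  have "e \<notin> keys (f - single d 1)"
    using assms unfolding has_lead_def by (meson not_less)
  then have "lookup (f - single d 1) e = 0" by (simp add: in_keys_iff)
  then show ?thesis by (simp add: lookup_minus lookup_single when_def)
qed

lemma has_lead_single: "has_lead (single d 1) d"
  by (simp add: has_lead_def)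

lemma has_lead_mult:
  assumes "has_lead f d" "has_lead g e"
  shows "has_lead (f * g) (d + e)"
proof -
  define r where "r = f - single d 1"
  define s where "s = g - single e 1"
  have r: "deg k < deg d" if "k \<in> keys r" for k using assms that by (auto simp: has_lead_def r_def)
  have s: "deg k < deg e" if "k \<in> keys s" for k using assms that by (auto simp: has_lead_def s_def)
  have f: "f = single d 1 + r" and g: "g = single e 1 + s" by (simp_all add: r_def s_def)
  \<comment> \<open>Each of the three remaining products contains at least one factor of lower
    order.\<close>
  have eq: "f * g - single (d + e) 1 = single d 1 * s + (single e 1 * r + r * s)"
    unfolding f g by (simp add: distrib_left distrib_right mult_single mult.commute)
  have 1: "deg k < deg (d + e)" if "k \<in> keys (single d 1 * s)" for k
    using that keys_single_times[of d 1 s] s by (auto simp: deg_add)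
  have 2: "deg k < deg (d + e)" if "k \<in> keys (single e 1 * r)" for k
    using that keys_single_times[of e 1 r] r by (auto simp: deg_add)
  have 3: "deg k < deg (d + e)" if "k \<in> keys (r * s)" for k
  proof -
    obtain a b where "k = a + b" "a \<in> keys r" "b \<in> keys s"
      using \<open>k \<in> keys (r * s)\<close> keys_mult[of r s] by blast
    then show ?thesis using r[of a] s[of b] by (simp add: deg_add)
  qed
  show ?thesis
    unfolding has_lead_def eq
  proof
    fix k assume "k \<in> keys (single d 1 * s + (single e 1 * r + r * s))"
    then have "k \<in> keys (single d 1 * s) \<union> (keys (single e 1 * r) \<union> keys (r * s))"
      using keys_add[of "single d 1 * s" "single e 1 * r + r * s"]
        keys_add[of "single e 1 * r" "r * s"] by blast
    then show "deg k < deg (d + e)" using 1 2 3 by blast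
  qed
qed

lemma has_lead_one: "has_lead 1 0"
  by (simp add: has_lead_def)

lemma has_lead_T: "has_lead (T n) (var n)"
  by (simp add: has_lead_def T_eq deg_diff deg_single deg_Aexp)

section \<open>Products of generators as a basis\<close>

definition Y_exponents :: "(('i \<times> complex) \<Rightarrow>\<^sub>0 int) set" where
  "Y_exponents = {d. keys d \<subseteq> (UNIV - {i}) \<times> range (\<lambda>n::int. t powi n)}"

definition T_exponents :: "(('i \<times> complex) \<Rightarrow>\<^sub>0 int) set" where
  "T_exponents = {e. keys e \<subseteq> {i} \<times> range (\<lambda>n::int. t powi n) \<and> (\<forall>p. lookup e p \<ge> 0)}"

text \<open>Substitutes \<open>T n\<close> for Y_i(zt^n) in the monomial with exponent
  \<open>e\<close>; on \<open>T_exponents\<close> the conversion \<open>nat\<close> loses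
  nothing.\<close>

definition T_monomial :: "(('i \<times> complex) \<Rightarrow>\<^sub>0 int) \<Rightarrow> 'i laurent" where
  "T_monomial e = (\<Prod>p\<in>keys e. T (idx (snd p)) ^ nat (lookup e p))"

lemma T_monomial_superset:
  assumes "finite K" "keys e \<subseteq> K"
  shows "T_monomial e = (\<Prod>p\<in>K. T (idx (snd p)) ^ nat (lookup e p))"
  unfolding T_monomial_def
  by (rule prod.mono_neutral_left) (use assms in \<open>auto simp: in_keys_iff\<close>)

lemma T_exponents_add:
  assumes "d \<in> T_exponents" "e \<in> T_exponents"
  shows "d + e \<in> T_exponents"
  using assms keys_add[of d e] by (auto simp: T_exponents_def lookup_add)

lemma T_exponents_nonneg: "e \<in> T_exponents \<Longrightarrow> lookup e p \<ge> 0"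
  by (cases p) (simp add: T_exponents_def)

lemma T_monomial_add:
  assumes "d \<in> T_exponents" "e \<in> T_exponents"
  shows "T_monomial (d + e) = T_monomial d * T_monomial e"
proof -
  \<comment> \<open>A common index set for the three products lets them be compared factor by
    factor.\<close>
  have "T_monomial f = (\<Prod>p\<in>keys d \<union> keys e. T (idx (snd p)) ^ nat (lookup f p))"
    if "f \<in> {d, e, d + e}" for f
    by (rule T_monomial_superset) (use that keys_add[of d e] in auto)
  moreover have "nat (lookup (d + e) p) = nat (lookup d p) + nat (lookup e p)" for p
    using assms by (simp add: T_exponents_nonneg lookup_add nat_add_distrib)
  ultimately show ?thesis by (simp add: power_add prod.distrib)
qed

lemma T_monomial_0 [simp]: "T_monomial 0 = 1"
  by (simp add: T_monomial_def)

lemma zero_in_T_exponents: "0 \<in> T_exponents" and var_in_T_exponents: "var n \<in> T_exponents"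
  by (auto simp: T_exponents_def lookup_single when_def)

lemma T_monomial_var: "T_monomial (var n) = T n"
  by (simp add: T_monomial_def)

lemma T_monomial_in_subalgebra: "T_monomial e \<in> subalgebra_generated (T_gens C t i)"
  unfolding T_monomial_def T_gens_eq
  by (intro subalgebra_prod subalgebra_power subalgebra_generated.gen rangeI)

lemma has_lead_T_monomial:
  assumes "e \<in> T_exponents"
  shows "has_lead (T_monomial e) e"
proof -
  have pow: "has_lead (T n ^ k) (single (i, t powi n) (int k))" for n k
  proof (induction k)
    case 0
    then show ?case by (simp add: has_lead_one)
  next
    case (Suc k)
    then show ?case using has_lead_mult[OF has_lead_T[of n] Suc] by (simp flip: single_add)
  qed
  have "has_lead (\<Prod>p\<in>K. T (idx (snd p)) ^ nat (lookup e p)) (\<Sum>p\<in>K. single p (lookup e p))"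
    if "finite K" "K \<subseteq> keys e" for K
    using that
  proof (induction K rule: finite_induct)
    case empty
    then show ?case by (simp add: has_lead_one)
  next
    case (insert p K)
    from insert.prems assms obtain n where "p = (i, t powi n)" by (force simp: T_exponents_def)
    moreover have "lookup e p \<ge> 0" using assms by (rule T_exponents_nonneg)
    ultimately have "has_lead (T (idx (snd p)) ^ nat (lookup e p)) (single p (lookup e p))"
      using pow[of n "nat (lookup e p)"] by simp
    with insert show ?case by (simp add: has_lead_mult)
  qed
  from this[OF finite_keys order_refl] show ?thesis
    by (simp add: T_monomial_def flip: poly_mapping_eq_sum_single)
qed

abbreviation U_alg :: "'i laurent set" where
  "U_alg \<equiv> subalgebra_generated (Y_gens t (UNIV - {i}))"

abbreviation V_alg :: "'i laurent set" where
  "V_alg \<equiv> subalgebra_generated (T_gens C t i)"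

lemma span_le_subalgebra:
  assumes "B \<subseteq> subalgebra_generated G"
  shows "Laurent.span B \<subseteq> subalgebra_generated G"
proof
  fix f assume "f \<in> Laurent.span B"
  then show "f \<in> subalgebra_generated G"
    by (induction rule: Laurent.span_induct_alt)
      (use assms in \<open>auto intro: subalgebra_zero subalgebra_generated.add subalgebra_const_times\<close>)
qed

lemma U_alg_eq_span: "U_alg = Laurent.span ((\<lambda>d. single d 1) ` Y_exponents)"
proof
  show "Laurent.span ((\<lambda>d. single d 1) ` Y_exponents) \<subseteq> U_alg"
    by (rule span_le_subalgebra) (auto simp: Y_exponents_def intro: monomial_in_subalgebra)
  show "U_alg \<subseteq> Laurent.span ((\<lambda>d. single d 1) ` Y_exponents)"
  proof
    fix f assume "f \<in> U_alg"
    then have D: "keys f \<subseteq> Y_exponents" by (auto simp: Y_subalgebra_iff Y_exponents_def)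
    have "(\<Sum>d\<in>keys f. const (lookup f d) * single d 1) \<in> Laurent.span ((\<lambda>d. single d 1) ` Y_exponents)"
      using D by (intro Laurent.span_sum Laurent.span_scale Laurent.span_base) auto
    then show "f \<in> Laurent.span ((\<lambda>d. single d 1) ` Y_exponents)"
      by (simp add: const_def mult_single flip: poly_mapping_eq_sum_single)
  qed
qed

text \<open>The span contains the constants and every \<open>T n\<close>, and by
  \<open>T_monomial_add\<close> it is closed under multiplication.\<close>

lemma V_alg_eq_span: "V_alg = Laurent.span (T_monomial ` T_exponents)"
proof
  show "Laurent.span (T_monomial ` T_exponents) \<subseteq> V_alg"
    by (rule span_le_subalgebra) (auto intro: T_monomial_in_subalgebra)
  have mult: "f * g \<in> Laurent.span (T_monomial ` T_exponents)"
    if f: "f \<in> Laurent.span (T_monomial ` T_exponents)"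
      and g: "g \<in> Laurent.span (T_monomial ` T_exponents)"
    for f g
    using f
  proof (induction rule: Laurent.span_induct_alt)
    case base
    then show ?case by (simp add: Laurent.span_zero)
  next
    case (step c x y)
    have "x * g \<in> Laurent.span (T_monomial ` T_exponents)"
      using g
    proof (induction rule: Laurent.span_induct_alt)
      case base
      then show ?case by (simp add: Laurent.span_zero)
    next
      case (step c' x' y')
      have "x * x' \<in> Laurent.span (T_monomial ` T_exponents)"
        using step.hyps \<open>x \<in> T_monomial ` T_exponents\<close>
        by (auto simp flip: T_monomial_add intro!: Laurent.span_base T_exponents_add)
      from Laurent.span_add[OF Laurent.span_scale[OF this, of c'] step.IH]
      show ?case by (simp only: distrib_left distrib_right mult_ac)
    qed
    from Laurent.span_add[OF Laurent.span_scale[OF this, of c] step.IH]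
    show ?case by (simp only: distrib_left distrib_right mult_ac)
  qed
  show "V_alg \<subseteq> Laurent.span (T_monomial ` T_exponents)"
  proof
    fix f assume "f \<in> V_alg"
    then show "f \<in> Laurent.span (T_monomial ` T_exponents)"
    proof induction
      case (const c)
      have "T_monomial 0 \<in> Laurent.span (T_monomial ` T_exponents)"
        by (intro Laurent.span_base imageI zero_in_T_exponents)
      from Laurent.span_scale[OF this, of c] show ?case by simp
    next
      case (gen g)
      then obtain n where "g = T_monomial (var n)" by (auto simp: T_gens_eq T_monomial_var)
      then show ?case using var_in_T_exponents by (auto intro: Laurent.span_base)
    qed (auto intro: Laurent.span_add mult)
  qed
qed

lemma has_lead_basis:
  assumes "d \<in> Y_exponents" "e \<in> T_exponents"
  shows "has_lead (single d 1 * T_monomial e) (d + e)" "deg (d + e) = deg e"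
proof -
  show "has_lead (single d 1 * T_monomial e) (d + e)"
    by (intro has_lead_mult has_lead_single has_lead_T_monomial assms)
  have "deg d = 0"
    using assms(1) by (auto simp: deg_def extend_def Y_exponents_def intro!: sum.neutral)
  then show "deg (d + e) = deg e" by (simp add: deg_add)
qed

text \<open>The two summands have disjoint supports: \<open>d\<close> is the part of the sum away
  from index \<open>i\<close>.\<close>

lemma exponents_sum_unique:
  assumes "d \<in> Y_exponents" "e \<in> T_exponents" "d' \<in> Y_exponents" "e' \<in> T_exponents"
    and "d + e = d' + e'"
  shows "d = d' \<and> e = e'"
proof -
  have "lookup d p = (if fst p = i then 0 else lookup (d + e) p)"
    if "d \<in> Y_exponents" "e \<in> T_exponents" for d e p
  proof (cases "fst p = i")
    case True
    then have "p \<notin> keys d" using that(1) by (auto simp: Y_exponents_def)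
    then show ?thesis using True by (simp add: in_keys_iff)
  next
    case False
    then have "p \<notin> keys e" using that(2) by (auto simp: T_exponents_def)
    then show ?thesis using False by (simp add: in_keys_iff lookup_add)
  qed
  from this[OF assms(1,2)] this[OF assms(3,4)] have "lookup d p = lookup d' p" for p
    unfolding assms(5) by simp
  then have "d = d'" by (rule poly_mapping_eqI)
  then show ?thesis using assms(5) by simp
qed

text \<open>The products have pairwise different leading exponents. At the leading exponent of a
  pair of maximal degree in \<open>w\<close> no other product contributes, so the coefficient of
  that pair would vanish.\<close>

lemma basis_products_independent:
  assumes w: "w \<in> free_on ((\<lambda>d. single d 1) ` Y_exponents \<times> T_monomial ` T_exponents)"
    and 0: "multiplication_map w = 0"
  shows "w = 0"
proof (rule ccontr)
  assume "w \<noteq> 0"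
  have "\<exists>d e. d \<in> Y_exponents \<and> e \<in> T_exponents \<and> p = (single d 1, T_monomial e)"
    if "p \<in> keys w" for p
    using w that unfolding free_on_def by blast
  then obtain dd ee where de: "\<And>p. p \<in> keys w \<Longrightarrow>
      dd p \<in> Y_exponents \<and> ee p \<in> T_exponents \<and> p = (single (dd p) 1, T_monomial (ee p))"
    by metis
  have "Max ((\<lambda>p. deg (ee p)) ` keys w) \<in> (\<lambda>p. deg (ee p)) ` keys w"
    using \<open>w \<noteq> 0\<close> by (intro Max_in) auto
  then obtain p where p: "p \<in> keys w" "Max ((\<lambda>p. deg (ee p)) ` keys w) = deg (ee p)" by auto
  then have max: "deg (ee q) \<le> deg (ee p)" if "q \<in> keys w" for q
    using that by (metis Max_ge finite_imageI finite_keys imageI)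
  have coeff: "lookup (fst q * snd q) (dd p + ee p) = (if q = p then 1 else 0)"
    if q: "q \<in> keys w" for q
  proof -
    have "fst q * snd q = single (dd q) 1 * T_monomial (ee q)"
      using de[OF q] by (metis fst_conv snd_conv)
    moreover have "has_lead (single (dd q) 1 * T_monomial (ee q)) (dd q + ee q)"
      "deg (dd q + ee q) \<le> deg (dd p + ee p)"
      using de[OF q] de[OF p(1)] has_lead_basis max[OF q] by metis+
    ultimately have "lookup (fst q * snd q) (dd p + ee p) =
        (if dd p + ee p = dd q + ee q then 1 else 0)"
      using lookup_has_lead by simp
    moreover have "dd p + ee p = dd q + ee q \<longleftrightarrow> q = p"
      using exponents_sum_unique[of "dd p" "ee p" "dd q" "ee q"] de[OF q] de[OF p(1)] by metis
    ultimately show ?thesis by simp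
  qed
  have "lookup (multiplication_map w) (dd p + ee p) =
      (\<Sum>q\<in>keys w. if q = p then lookup w q else 0)"
    unfolding multiplication_map_def lookup_sum mult.assoc lookup_const_times
    by (rule sum.cong) (simp_all add: coeff)
  also have "\<dots> = lookup w p" using p(1) by simp
  finally show False using 0 p(1) by (simp add: in_keys_iff)
qed

section \<open>Elimination of dominant monomials\<close>

definition i_part :: "(('i \<times> complex) \<Rightarrow>\<^sub>0 int) \<Rightarrow> ('i \<times> complex) \<Rightarrow>\<^sub>0 int" where
  "i_part d = (\<Sum>p\<in>keys d. if fst p = i then single p (lookup d p) else 0)"

lemma lookup_i_part: "lookup (i_part d) p = (if fst p = i then lookup d p else 0)"
proof -
  have "lookup (i_part d) p = (\<Sum>q\<in>keys d. if q = p then if fst p = i then lookup d p else 0 else 0)"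
    unfolding i_part_def lookup_sum by (rule sum.cong) (auto simp: lookup_single when_def)
  then show ?thesis by (simp add: in_keys_iff)
qed

text \<open>With \<open>has_lead_basis\<close>, every dominant exponent supported on powers of
  \<open>t\<close> is the leading exponent of a basis product.\<close>

lemma dominant_split:
  assumes "keys d \<subseteq> UNIV \<times> range (\<lambda>n::int. t powi n)" "dominant d"
  shows "d - i_part d \<in> Y_exponents" "i_part d \<in> T_exponents"
proof -
  show "d - i_part d \<in> Y_exponents"
    using assms(1) by (force simp: Y_exponents_def in_keys_iff lookup_minus lookup_i_part
        split: if_splits)
  \<comment> \<open>Dominance speaks only of powers of \<open>t\<close>; at other points the
    exponent is zero by the support hypothesis.\<close>
  have "lookup d (i, a) \<ge> 0" for a
  proof (cases "(i, a) \<in> keys d")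
    case True
    then obtain n where "a = t powi n" using assms(1) by auto
    then show ?thesis using assms(2) by (simp add: dominant_def)
  qed (simp add: in_keys_iff)
  then show "i_part d \<in> T_exponents"
    using assms(1) by (force simp: T_exponents_def in_keys_iff lookup_i_part
        split: if_splits)
qed

text \<open>
  Subtracting the products of the generators with the same leading terms lowers the degree of the
  dominant monomials, which is bounded below by zero.
\<close>

lemma lifted_kernel_subset_image:
  "lifted_kernel C t i \<subseteq> multiplication_map ` free_on (U_alg \<times> V_alg)" (is "_ \<subseteq> ?I")
proof -
  have I_add: "f + g \<in> ?I" if "f \<in> ?I" "g \<in> ?I" for f g
    using that by (auto simp flip: multiplication_map_add intro!: imageI free_on_add)
  have I_0: "0 \<in> ?I" using imageI[OF free_on_zero, of multiplication_map] by simp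
  have I_sum: "sum h X \<in> ?I" if "\<And>x. x \<in> X \<Longrightarrow> h x \<in> ?I" for X and h :: "_ \<Rightarrow> 'i laurent"
    using that by (induction X rule: infinite_finite_induct) (simp_all add: I_0 I_add)
  have I_prod: "const c * (u * v) \<in> ?I" if "u \<in> U_alg" "v \<in> V_alg" for c u v
  proof
    show "const c * (u * v) = multiplication_map (single (u, v) c)" by (simp add: mult.assoc)
    show "single (u, v) c \<in> free_on (U_alg \<times> V_alg)" using that by (intro free_on_single) simp
  qed
  \<comment> \<open>Induction on a bound \<open>b\<close> for the degrees of dominant monomials. For
    b = 0 there are none, since dominance forces a nonnegative degree, and
    \<open>exists_dominant\<close> gives f = 0.\<close>
  have "f \<in> ?I" if "f \<in> lifted_kernel C t i" "\<forall>d\<in>keys f. dominant d \<longrightarrow> deg d < int b" for f b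
    using that
  proof (induction b arbitrary: f)
    case 0
    have "f = 0"
    proof (rule ccontr)
      assume "f \<noteq> 0"
      then obtain d where d: "d \<in> keys f" "dominant d" using exists_dominant 0 by blast
      have "keys d \<subseteq> UNIV \<times> range (\<lambda>n::int. t powi n)"
        using 0(1) d(1) by (auto simp: lifted_kernel_def Y_algebra_def Y_subalgebra_iff)
      with d(2) have "deg d \<ge> 0"
        unfolding deg_def extend_def dominant_def by (intro sum_nonneg) auto
      with 0(2) d show False by force
    qed
    then show ?case using I_0 by simp
  next
    case (Suc b)
    define P where "P = {d \<in> keys f. dominant d \<and> deg d = int b}"
    define B where "B d = single (d - i_part d) 1 * T_monomial (i_part d)" for d
    define r where "r = (\<Sum>d\<in>P. const (lookup f d) * B d)"
    have fin: "finite P" by (simp add: P_def)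
    have split: "d - i_part d \<in> Y_exponents" "i_part d \<in> T_exponents" if "d \<in> P" for d
    proof -
      have "keys d \<subseteq> UNIV \<times> range (\<lambda>n::int. t powi n)"
        using Suc.prems(1) that
        by (auto simp: P_def lifted_kernel_def Y_algebra_def Y_subalgebra_iff)
      then show "d - i_part d \<in> Y_exponents" "i_part d \<in> T_exponents"
        using dominant_split that by (auto simp: P_def)
    qed
    have lead: "has_lead (B d) d" if "d \<in> P" for d
      using has_lead_basis(1)[OF split[OF that]] by (simp add: B_def)
    have r_I: "r \<in> ?I"
      unfolding r_def B_def
      by (intro I_sum I_prod T_monomial_in_subalgebra)
        (use split in \<open>auto simp: Y_exponents_def intro: monomial_in_subalgebra\<close>)
    then have "r \<in> lifted_kernel C t i"
      using image_multiplication_map_subset[of "Y_gens t (UNIV - {i})" "T_gens C t i"]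
        subalgebra_le_lifted_kernel by blast
    then have K: "f - r \<in> lifted_kernel C t i" by (intro lifted_kernel_diff Suc.prems)
    have "deg k < int b" if k: "k \<in> keys (f - r)" "dominant k" for k
    proof (rule ccontr)
      assume neg: "\<not> deg k < int b"
      \<comment> \<open>Every \<open>d\<close> in \<open>P\<close> has degree \<open>b\<close>, so
        in degree at least \<open>b\<close> only the leading terms of the \<open>B d\<close> are
        visible.\<close>
      have "lookup r k = (\<Sum>d\<in>P. if d = k then lookup f d else 0)"
        unfolding r_def lookup_sum lookup_const_times
        by (rule sum.cong) (use lookup_has_lead[OF lead] neg in \<open>auto simp: P_def\<close>)
      also have "\<dots> = (if k \<in> P then lookup f k else 0)" using fin by simp
      finally have *: "k \<notin> P" "k \<in> keys f"
        using k(1) by (auto simp: in_keys_iff lookup_minus split: if_splits)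
      then have "deg k < int (Suc b)" using Suc.prems(2) k(2) by blast
      with neg * k(2) show False by (simp add: P_def)
    qed
    then have "f - r \<in> ?I" using Suc.IH[OF K] by blast
    from I_add[OF this r_I] show ?case by simp
  qed
  moreover have "\<exists>b. \<forall>d\<in>keys f. dominant d \<longrightarrow> deg d < int b" for f
  proof -
    \<comment> \<open>Inserting 0 makes the maximum exist for f = 0 and keeps \<open>nat\<close>
      from truncating it.\<close>
    have "\<forall>d\<in>keys f. deg d < int (nat (Max (insert 0 (deg ` keys f)) + 1))"
    proof
      fix d assume "d \<in> keys f"
      then have "deg d \<le> Max (insert 0 (deg ` keys f))" by (intro Max_ge) auto
      then show "deg d < int (nat (Max (insert 0 (deg ` keys f)) + 1))" by linarith
    qed
    then show ?thesis by blast
  qed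
  ultimately show ?thesis by blast
qed

text \<open>A circle of inclusions: the kernel lies in the image of multiplication, the image in the
  generated subalgebra, and the subalgebra in the kernel.\<close>

lemma lifted_kernel_eq:
  "lifted_kernel C t i = multiplication_map ` free_on (U_alg \<times> V_alg)"
  "lifted_kernel C t i = subalgebra_generated (Y_gens t (UNIV - {i}) \<union> T_gens C t i)"
  using lifted_kernel_subset_image subalgebra_le_lifted_kernel
    image_multiplication_map_subset[of "Y_gens t (UNIV - {i})" "T_gens C t i"]
  by blast+

lemma is_tensor_product_lifted_kernel: "is_tensor_product U_alg V_alg (lifted_kernel C t i)"
  unfolding is_tensor_product_def
  using lifted_kernel_eq(1)
    bilinear_relations_eqI[OF U_alg_eq_span V_alg_eq_span basis_products_independent] by blast

end

theorem proposition3p2: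
  fixes scale :: "complex \<Rightarrow> 'g::ab_group_add \<Rightarrow> 'g"
    and Basis :: "'g set"
    and bracket :: "'g \<Rightarrow> 'g \<Rightarrow> 'g"
    and H :: "'g set"
    and \<alpha> :: "'i::finite \<Rightarrow> 'g \<Rightarrow> complex"
    and C :: "'i \<Rightarrow> 'i \<Rightarrow> int"
    and i :: 'i
    and t :: complex
    and S :: "'i laurent \<Rightarrow> 'i screening_module set"
  assumes "simple_lie_algebra_with_cartan_matrix scale Basis bracket H \<alpha> C"
    and "t \<noteq> 0"
    and "\<forall>n::nat. n > 0 \<longrightarrow> t ^ n \<noteq> 1"
    and "screening_operator C t i S"
  shows "is_tensor_product
           (subalgebra_generated (Y_gens t (UNIV - {i})))
           (subalgebra_generated (T_gens C t i))
           (screening_kernel C t i S) \<and>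
         screening_kernel C t i S =
           subalgebra_generated (Y_gens t (UNIV - {i}) \<union> T_gens C t i)"
proof -
  interpret generic_screening C t i
    by unfold_locales (use assms in auto)
  show ?thesis
    using is_tensor_product_lifted_kernel lifted_kernel_eq(2)
      screening_kernel_eq_lifted_kernel[OF assms(4)] by simp
qed

end
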